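(* Let $\xi:[0,\infty)\to\mathbb{R}$ be continuous (deterministic), and let $g_t$ be the corresponding solution of Loewner's equation $\partial_t g_t(z)=\frac{2}{g_t(z)-\xi(t)}$, $g_0(z)=z$. Assume that $$\beta(t):=\lim_{y\searrow0}g_t^{-1}(\xi(t)+iy)$$ exists for all $t\in[0,\infty)$ and is continuous in $t$. Then for every $t\in[0,\infty)$, $g_t^{-1}$ extends continuously to $\overline{\mathbb{H}}$ and $H_t$ is the unbounded connected component of $\mathbb{H}\setminus\beta([0,t])$.
   Context: $\mathbb{H}$ is the open upper half plane and $\overline{\mathbb{H}}$ its closure in $\mathbb{C}$. For $z\in\mathbb{H}$ the solution $g_t(z)$ exists as long as $g_t(z)-\xi(t)$ is bounded away from zero; $\tau(z)\in(0,\infty]$ is the first time $\tau$ such that $0$ is a limit point of $g_t(z)-\xi(t)$ as $t\nearrow\tau$ ($\tau(z)=\infty$ if there is none). $H_t:=\{z\in\mathbb{H}:\tau(z)>t\}$, and $g_t:H_t\to\mathbb{H}$ is a conformal homeomorphism with inverse $g_t^{-1}:\mathbb{H}\to H_t$. *)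

theory Defs
  imports "HOL-Analysis.Analysis"
begin

abbreviation upper_half_plane :: "complex set" where
  "upper_half_plane \<equiv> {z. Im z > 0}"

text \<open>The differential equation on \<open>[0, T)\<close>, with \<open>T = \<infinity>\<close> allowed; at time \<open>0\<close> the derivative
  is one-sided. The condition \<open>u t \<noteq> \<xi> t\<close> is explicit because division by zero is total in HOL.\<close>

definition solves_loewner ::
    "(real \<Rightarrow> real) \<Rightarrow> complex \<Rightarrow> ereal \<Rightarrow> (real \<Rightarrow> complex) \<Rightarrow> bool" where
  "solves_loewner \<xi> z T u \<longleftrightarrow>
     u 0 = z \<and>
     (\<forall>t. 0 \<le> t \<and> ereal t < T \<longrightarrow>
        u t \<noteq> complex_of_real (\<xi> t) \<and>
        (u has_vector_derivative 2 / (u t - complex_of_real (\<xi> t)))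
          (at t within {s. 0 \<le> s \<and> ereal s < T}))"

text \<open>\<open>0\<close> is a limit point of \<open>u t - \<xi> t\<close> as \<open>t\<close> increases to \<open>s\<close>.\<close>

definition hits_driving_at :: "(real \<Rightarrow> real) \<Rightarrow> (real \<Rightarrow> complex) \<Rightarrow> real \<Rightarrow> bool" where
  "hits_driving_at \<xi> u s \<longleftrightarrow>
     (\<forall>\<epsilon>>0. \<exists>\<^sub>F t in at_left s. norm (u t - complex_of_real (\<xi> t)) < \<epsilon>)"

definition first_hitting_time :: "(real \<Rightarrow> real) \<Rightarrow> (real \<Rightarrow> complex) \<Rightarrow> ereal \<Rightarrow> bool" where
  "first_hitting_time \<xi> u T \<longleftrightarrow>
     0 < T \<and>
     (\<forall>s>0. ereal s < T \<longrightarrow> \<not> hits_driving_at \<xi> u s) \<and>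
     (\<forall>s. T = ereal s \<longrightarrow> hits_driving_at \<xi> u s)"

text \<open>\<open>g t z\<close> is the solution started at \<open>z\<close> and \<open>\<tau> z\<close> its lifetime. The values \<open>g t z\<close> for
  \<open>t \<ge> \<tau> z\<close>, or for \<open>z\<close> outside the upper half plane, are unconstrained and irrelevant.\<close>

definition loewner_flow ::
    "(real \<Rightarrow> real) \<Rightarrow> (real \<Rightarrow> complex \<Rightarrow> complex) \<Rightarrow> (complex \<Rightarrow> ereal) \<Rightarrow> bool" where
  "loewner_flow \<xi> g \<tau> \<longleftrightarrow>
     (\<forall>z\<in>upper_half_plane.
        solves_loewner \<xi> z (\<tau> z) (\<lambda>t. g t z) \<and>
        first_hitting_time \<xi> (\<lambda>t. g t z) (\<tau> z))"

definition loewner_domain :: "(complex \<Rightarrow> ereal) \<Rightarrow> real \<Rightarrow> complex set" where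
  "loewner_domain \<tau> t = {z \<in> upper_half_plane. ereal t < \<tau> z}"

definition loewner_inverse ::
    "(real \<Rightarrow> complex \<Rightarrow> complex) \<Rightarrow> (complex \<Rightarrow> ereal) \<Rightarrow> real \<Rightarrow> complex \<Rightarrow> complex" where
  "loewner_inverse g \<tau> t = inv_into (loewner_domain \<tau> t) (g t)"

end

theory Submission
  imports Defs "HOL-Complex_Analysis.Conformal_Mappings"
begin

text \<open>
  Write \<open>f t\<close> for the inverse of \<open>g t\<close> and \<open>H t\<close> for its image. Two facts about conformal maps of the
  half plane carry the proof, and both rest on the same length-area estimate: around every real
  point there are arbitrarily small semicircles whose \<open>f t\<close>-images have arbitrarily small diameter
  (\<open>short_crosscuts\<close>). The length-area argument is carried out on a grid of squares in logarithmic
  coordinates, where Bloch's theorem replaces the change of variables formula: the image of a square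
  of side \<open>h\<close> contains a disc of radius comparable to \<open>h\<close> times the derivative at the centre,
  these discs are disjoint, and their total area is bounded.

  The first fact is that the limits of \<open>f t\<close> along two arcs ending at the same real point agree
  (\<open>limits_along_arcs_agree\<close>), because both arcs cross all small semicircles. The second one is
  that \<open>f t\<close> has a limit at every real point as soon as the frontier of its image lies in a closed
  locally connected set \<open>T\<close> disjoint from the image (\<open>limit_at_real_point\<close>). Indeed the image of
  a short semicircle together with a small connected piece of \<open>T\<close> is a small continuum; by
  Janiszewski's theorem its union with \<open>T\<close> does not separate two points of the image outside a
  small disc, whereas the image of the semicircle does separate the image of the enclosed half disc
  from the rest.

  With \<open>T\<close> the union of the real line and \<open>\<beta> ` {0..t}\<close>, which is locally connected because \<open>\<beta>\<close> is
  continuous, it remains to see that the frontier of \<open>H t\<close> inside the half plane lies on the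
  curve (\<open>frontier_domain_subset_curve\<close>). Near a frontier point \<open>z\<close> choose \<open>p\<close> in \<open>H t\<close> and walk from
  \<open>p\<close> to \<open>z\<close> up to the first point \<open>q\<close> where the lifetime is minimal along the segment, say equal to
  \<open>\<sigma>\<close>. The open piece of the segment lies in \<open>H \<sigma>\<close>, and \<open>g \<sigma>\<close> tends to \<open>\<xi> \<sigma>\<close> along it, since a point that
  dies at time \<open>\<sigma>\<close> is shortly before that so close to the driving point that no nearby trajectory
  can escape (\<open>flow_tends_to_driving\<close>). So \<open>f \<sigma>\<close> has the limit \<open>q\<close> along an arc ending at \<open>\<xi> \<sigma>\<close>,
  and therefore \<open>q = \<beta> \<sigma>\<close>. As \<open>q\<close> is as close to \<open>z\<close> as desired and the curve is closed,
  \<open>z\<close> is on the curve.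

  Conversely no \<open>\<beta> s\<close> with \<open>s \<le> t\<close> lies in \<open>H t\<close>, and \<open>H t\<close> is connected and contains all points of the half
  plane far from the origin, which identifies it as the unbounded component.
\<close>

section \<open>Tools for ordinary differential equations\<close>

text \<open>The integrating factor. It is applied to the complex difference of two Loewner trajectories and to
  the real imaginary part of one; hence the general coefficient field.\<close>

lemma linear_ode_solution:
  fixes v a :: "real \<Rightarrow> 'a::{real_normed_field,banach}"
  assumes "s \<le> t" and cont: "continuous_on {s..t} a"
    and deriv: "\<And>r. r \<in> {s..t} \<Longrightarrow> (v has_vector_derivative a r * v r) (at r within {s..t})"
  shows "v t = v s * exp (integral {s..t} a)"
proof -
  define A where "A = (\<lambda>r. integral {s..r} a)"
  have A: "(A has_vector_derivative a r) (at r within {s..t})" if "r \<in> {s..t}" for r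
    unfolding A_def using integral_has_vector_derivative[OF cont that] .
  have E: "((\<lambda>r. exp (- A r)) has_vector_derivative - a r * exp (- A r)) (at r within {s..t})"
    if "r \<in> {s..t}" for r
  proof -
    have "((\<lambda>r. - A r) has_vector_derivative - a r) (at r within {s..t})"
      using A[OF that] by (rule has_vector_derivative_minus)
    from field_vector_diff_chain_within[OF this, of exp "exp (- A r)"]
    show ?thesis by (simp add: o_def DERIV_subset[OF DERIV_exp])
  qed
  have "((\<lambda>r. v r * exp (- A r)) has_vector_derivative 0) (at r within {s..t})"
    if "r \<in> {s..t}" for r
    using has_vector_derivative_mult[OF deriv[OF that] E[OF that]]
    by (simp add: algebra_simps)
  then obtain c where c: "\<And>r. r \<in> {s..t} \<Longrightarrow> v r * exp (- A r) = c"
    using has_vector_derivative_zero_constant[OF convex_real_interval(5), of s t "\<lambda>r. v r * exp (- A r)"]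
    by blast
  have "v t = v t * exp (- A t) * exp (A t)" by (simp add: exp_minus)
  also have "v t * exp (- A t) = v s * exp (- A s)"
    using c[of t] c[of s] \<open>s \<le> t\<close> by simp
  finally show ?thesis by (simp add: A_def)
qed

text \<open>The a priori bound \<open>\<phi> \<le> B\<close> improves itself to a strict one, so at the first time where \<open>\<phi>\<close> reaches
  \<open>B\<close> there would be a contradiction.\<close>

lemma bootstrap:
  fixes \<phi> :: "real \<Rightarrow> real"
  assumes cont: "continuous_on {a..b} \<phi>" and "\<phi> a < B"
    and step: "\<And>r. a \<le> r \<Longrightarrow> r \<le> b \<Longrightarrow> (\<And>q. a \<le> q \<Longrightarrow> q \<le> r \<Longrightarrow> \<phi> q \<le> B) \<Longrightarrow> \<phi> r < B"
    and r: "a \<le> r" "r \<le> b"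
  shows "\<phi> r < B"
proof (rule ccontr)
  assume "\<not> \<phi> r < B"
  then have rB: "B \<le> \<phi> r" by simp
  define X where "X = {q \<in> {a..r}. B \<le> \<phi> q}"
  have cont_r: "continuous_on {a..r} \<phi>"
    by (rule continuous_on_subset[OF cont]) (use r in auto)
  have "X = {a..r} \<inter> \<phi> -` {B..}" by (auto simp: X_def)
  then have "closed X"
    using continuous_closed_preimage[OF cont_r closed_atLeastAtMost closed_atLeast] by simp
  moreover have "bounded X" unfolding X_def by (rule bounded_subset[of "{a..r}"]) auto
  ultimately have "compact X" by (simp add: compact_eq_bounded_closed)
  moreover have "X \<noteq> {}" using r rB by (auto simp: X_def)
  ultimately obtain m where m: "m \<in> X" and least: "\<And>q. q \<in> X \<Longrightarrow> m \<le> q"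
    using compact_attains_inf by metis
  have "\<exists>q\<ge>a. q \<le> m \<and> \<phi> q = B"
    using m \<open>\<phi> a < B\<close> by (intro IVT' continuous_on_subset[OF cont_r]) (auto simp: X_def)
  then obtain q where q: "a \<le> q" "q \<le> m" "\<phi> q = B" by blast
  then have "q = m" using least[of q] m by (auto simp: X_def)
  have "\<phi> m < B"
  proof (rule step)
    fix p assume p: "a \<le> p" "p \<le> m"
    show "\<phi> p \<le> B"
    proof (cases "p = m")
      case False
      then show ?thesis using least[of p] p m by (force simp: X_def)
    qed (use q \<open>q = m\<close> in auto)
  qed (use m r in \<open>auto simp: X_def\<close>)
  then show False using q \<open>q = m\<close> by simp
qed

lemma displacement_bound:
  fixes u :: "real \<Rightarrow> 'a::real_normed_vector"
  assumes "s \<le> t"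
    and "\<And>r. r \<in> {s..t} \<Longrightarrow> (u has_vector_derivative u' r) (at r within {s..t})"
    and "\<And>r. r \<in> {s..t} \<Longrightarrow> norm (u' r) \<le> B"
  shows "norm (u t - u s) \<le> B * (t - s)"
proof -
  have "norm (u t - u s) \<le> B * norm (t - s)"
  proof (rule differentiable_bound[of "{s..t}" u "\<lambda>r h. h *\<^sub>R u' r"])
    show "onorm (\<lambda>h. h *\<^sub>R u' r) \<le> B" if "r \<in> {s..t}" for r
      using assms(3)[OF that] by (intro onorm_le) (auto intro!: mult_left_mono simp: mult.commute[of B])
  qed (use assms in \<open>auto simp: has_vector_derivative_def\<close>)
  then show ?thesis using \<open>s \<le> t\<close> by simp
qed

section \<open>The Loewner flow\<close>

locale loewner_chain =
  fixes \<xi> :: "real \<Rightarrow> real" and g :: "real \<Rightarrow> complex \<Rightarrow> complex" and \<tau> :: "complex \<Rightarrow> ereal"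
  assumes driving_continuous: "continuous_on {0..} \<xi>"
    and flow: "loewner_flow \<xi> g \<tau>"
begin

abbreviation H :: "real \<Rightarrow> complex set" where "H t \<equiv> loewner_domain \<tau> t"

lemma mem_domain: "z \<in> H t \<longleftrightarrow> 0 < Im z \<and> ereal t < \<tau> z"
  by (simp add: loewner_domain_def)

lemma domain_antimono: "z \<in> H t \<Longrightarrow> s \<le> t \<Longrightarrow> z \<in> H s"
  by (auto simp: mem_domain intro: le_less_trans[of "ereal s" "ereal t"])

lemma lifetime_pos: "0 < Im z \<Longrightarrow> 0 < \<tau> z"
  using flow by (simp add: loewner_flow_def first_hitting_time_def)

lemma flow_initial: "0 < Im z \<Longrightarrow> g 0 z = z"
  using flow by (simp add: loewner_flow_def solves_loewner_def)

lemma domain_0: "H 0 = upper_half_plane"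
  using lifetime_pos by (auto simp: mem_domain zero_ereal_def)

lemma flow_avoids_driving: "z \<in> H t \<Longrightarrow> 0 \<le> t \<Longrightarrow> g t z \<noteq> of_real (\<xi> t)"
  using flow by (simp add: loewner_flow_def solves_loewner_def mem_domain)

lemma flow_deriv:
  assumes "z \<in> H t" "0 \<le> s" "r \<in> {s..t}"
  shows "((\<lambda>r. g r z) has_vector_derivative 2 / (g r z - of_real (\<xi> r))) (at r within {s..t})"
proof (rule has_vector_derivative_within_subset)
  show "((\<lambda>r. g r z) has_vector_derivative 2 / (g r z - of_real (\<xi> r)))
      (at r within {p. 0 \<le> p \<and> ereal p < \<tau> z})"
    using flow assms domain_antimono[OF assms(1), of r]
    by (auto simp: loewner_flow_def solves_loewner_def mem_domain)
  show "{s..t} \<subseteq> {p. 0 \<le> p \<and> ereal p < \<tau> z}"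
    using assms domain_antimono[OF assms(1)] by (auto simp: mem_domain)
qed

lemma flow_continuous: "z \<in> H t \<Longrightarrow> 0 \<le> s \<Longrightarrow> continuous_on {s..t} (\<lambda>r. g r z)"
  using flow_deriv
  by (meson continuous_on_eq_continuous_within has_vector_derivative_continuous)

lemma driving_continuous': "0 \<le> s \<Longrightarrow> continuous_on {s..t} \<xi>"
  by (rule continuous_on_subset[OF driving_continuous]) auto

text \<open>The bound is demanded only as long as the trajectory lives. A finite lifetime
  forces the trajectory to approach the driving function, so a uniform bound rules out that the
  lifetime ends before \<open>t\<close>.\<close>

lemma survives_if_away:
  assumes "0 < Im z" "0 < c"
    and away: "\<And>r. 0 \<le> r \<Longrightarrow> r \<le> t \<Longrightarrow> z \<in> H r \<Longrightarrow> c \<le> cmod (g r z - of_real (\<xi> r))"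
  shows "z \<in> H t"
proof (rule ccontr)
  assume "z \<notin> H t"
  then have "\<tau> z \<le> ereal t" using \<open>0 < Im z\<close> by (auto simp: mem_domain)
  then obtain \<sigma> where \<sigma>: "\<tau> z = ereal \<sigma>" "0 < \<sigma>" "\<sigma> \<le> t"
    using lifetime_pos[OF \<open>0 < Im z\<close>] by (cases "\<tau> z") auto
  have "hits_driving_at \<xi> (\<lambda>t. g t z) \<sigma>"
    using flow \<open>0 < Im z\<close> \<sigma>(1) by (simp add: loewner_flow_def first_hitting_time_def)
  then have "\<exists>\<^sub>F r in at_left \<sigma>. norm (g r z - of_real (\<xi> r)) < c"
    using \<open>0 < c\<close> by (simp add: hits_driving_at_def)
  moreover have "\<forall>\<^sub>F r in at_left \<sigma>. \<not> norm (g r z - of_real (\<xi> r)) < c"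
    using eventually_at_left_real[OF \<open>0 < \<sigma>\<close>]
  proof eventually_elim
    case (elim r)
    then show ?case
      using away[of r] \<sigma> \<open>0 < Im z\<close> by (auto simp: mem_domain not_less)
  qed
  ultimately show False by (simp add: frequently_def)
qed

text \<open>Subtracting the equations gives \<open>\<partial>\<^sub>t (u - v) = - 2 (u - v) / ((u - \<xi>) (v - \<xi>))\<close>. This formula yields
  injectivity, continuity and complex differentiability of \<open>g t\<close> all at once.\<close>

lemma flow_difference:
  assumes z: "z \<in> H t" and z': "z' \<in> H t" and "0 \<le> t"
  shows "g t z - g t z' = (z - z') *
    exp (integral {0..t} (\<lambda>r. - 2 / ((g r z - of_real (\<xi> r)) * (g r z' - of_real (\<xi> r)))))"
proof -
  let ?a = "\<lambda>r. - 2 / ((g r z - of_real (\<xi> r)) * (g r z' - of_real (\<xi> r)))"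
  have ne: "g r w - of_real (\<xi> r) \<noteq> 0" if "w \<in> H t" "r \<in> {0..t}" for w r
    using flow_avoids_driving[of w r] domain_antimono[of w t r] that by auto
  have "g t z - g t z' = (g 0 z - g 0 z') * exp (integral {0..t} ?a)"
  proof (rule linear_ode_solution)
    show "continuous_on {0..t} ?a"
      by (intro continuous_intros flow_continuous driving_continuous' z z') (use ne z z' in auto)
    show "((\<lambda>r. g r z - g r z') has_vector_derivative ?a r * (g r z - g r z')) (at r within {0..t})"
      if r: "r \<in> {0..t}" for r
    proof -
      have "2 / a - 2 / b = - 2 / (a * b) * (a - b)" if "a \<noteq> 0" "b \<noteq> 0" for a b :: complex
        using that by (simp add: field_simps)
      from this[OF ne[OF z r] ne[OF z' r]] show ?thesis
        using has_vector_derivative_diff[OF flow_deriv[OF z _ r] flow_deriv[OF z' _ r]] by simp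
    qed
  qed fact
  with z z' show ?thesis by (simp add: flow_initial mem_domain)
qed

text \<open>The imaginary part satisfies \<open>\<partial>\<^sub>t y = - 2 y / \<bar>u - \<xi>\<bar>\<^sup>2\<close>, so it stays positive and decreases.\<close>

lemma Im_flow:
  assumes z: "z \<in> H t" and "0 \<le> s" "s \<le> t"
  shows "Im (g t z) = Im (g s z) * exp (integral {s..t} (\<lambda>r. - (2 / (cmod (g r z - of_real (\<xi> r)))\<^sup>2)))"
proof (rule linear_ode_solution)
  let ?a = "\<lambda>r. - (2 / (cmod (g r z - of_real (\<xi> r)))\<^sup>2)"
  have ne: "g r z - of_real (\<xi> r) \<noteq> 0" if "r \<in> {s..t}" for r
    using flow_avoids_driving[of z r] domain_antimono[OF z, of r] that assms by auto
  show "continuous_on {s..t} ?a"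
    by (intro continuous_intros flow_continuous driving_continuous' z) (use ne assms in auto)
  show "((\<lambda>r. Im (g r z)) has_vector_derivative ?a r * Im (g r z)) (at r within {s..t})"
    if r: "r \<in> {s..t}" for r
    using bounded_linear.has_vector_derivative[OF bounded_linear_Im flow_deriv[OF z \<open>0 \<le> s\<close> r]]
    by (simp add: Im_divide cmod_power2)
qed fact

lemma Im_flow_pos: "z \<in> H t \<Longrightarrow> 0 \<le> t \<Longrightarrow> 0 < Im (g t z)"
  using Im_flow[of z t 0] by (simp add: flow_initial mem_domain)

lemma Im_flow_antimono:
  assumes z: "z \<in> H t" and "0 \<le> s" "s \<le> t"
  shows "Im (g t z) \<le> Im (g s z)"
proof -
  let ?I = "integral {s..t} (\<lambda>r. 2 / (cmod (g r z - of_real (\<xi> r)))\<^sup>2)"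
  have "?I \<ge> 0"
    by (cases "(\<lambda>r. 2 / (cmod (g r z - of_real (\<xi> r)))\<^sup>2) integrable_on {s..t}")
       (auto intro!: Henstock_Kurzweil_Integration.integral_nonneg simp: not_integrable_integral)
  then have "exp (- ?I) \<le> 1" by simp
  moreover have "0 < Im (g s z)"
    using Im_flow_pos[OF domain_antimono[OF z \<open>s \<le> t\<close>] \<open>0 \<le> s\<close>] .
  ultimately show ?thesis
    using Im_flow[OF assms] by (simp add: mult_left_le)
qed

lemma flow_difference_bound:
  assumes z: "z \<in> H t" and z': "z' \<in> H t" and "0 \<le> t" "0 < m"
    and away: "\<And>r. r \<in> {0..t} \<Longrightarrow> m \<le> cmod (g r z - of_real (\<xi> r)) * cmod (g r z' - of_real (\<xi> r))"
  shows "cmod (g t z - g t z') \<le> cmod (z - z') * exp (2 * t / m)"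
proof -
  let ?a = "\<lambda>r. - 2 / ((g r z - of_real (\<xi> r)) * (g r z' - of_real (\<xi> r)))"
  have pos: "0 < cmod (g r z - of_real (\<xi> r)) * cmod (g r z' - of_real (\<xi> r))" if "r \<in> {0..t}" for r
    using away[OF that] \<open>0 < m\<close> by linarith
  have ne: "(g r z - of_real (\<xi> r)) * (g r z' - of_real (\<xi> r)) \<noteq> 0" if "r \<in> {0..t}" for r
    using pos[OF that] by auto
  have "Re (integral {0..t} ?a) \<le> cmod (integral {0..t} ?a)" by (rule complex_Re_le_cmod)
  also have "\<dots> \<le> 2 / m * (t - 0)"
  proof (rule integral_bound)
    show "continuous_on {0..t} ?a"
      by (intro continuous_intros flow_continuous driving_continuous' z z') (use ne in auto)
    show "\<And>r. r \<in> {0..t} \<Longrightarrow> cmod (?a r) \<le> 2 / m"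
      using away pos \<open>0 < m\<close> by (auto simp: norm_divide norm_mult intro!: divide_left_mono)
  qed fact
  finally have "exp (Re (integral {0..t} ?a)) \<le> exp (2 * t / m)" by simp
  then show ?thesis
    unfolding flow_difference[OF z z' \<open>0 \<le> t\<close>] by (simp add: norm_mult mult_left_mono)
qed

lemma flow_distance_to_driving:
  assumes "z \<in> H t" "0 \<le> t"
  obtains c where "0 < c" "\<And>r. r \<in> {0..t} \<Longrightarrow> c \<le> cmod (g r z - of_real (\<xi> r))"
proof -
  have "continuous_on {0..t} (\<lambda>r. cmod (g r z - of_real (\<xi> r)))"
    by (intro continuous_intros flow_continuous driving_continuous' assms) auto
  then obtain p where p: "p \<in> {0..t}" and
    min: "\<And>r. r \<in> {0..t} \<Longrightarrow> cmod (g p z - of_real (\<xi> p)) \<le> cmod (g r z - of_real (\<xi> r))"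
    using continuous_attains_inf[OF compact_Icc, of 0 t] \<open>0 \<le> t\<close> by fastforce
  have "0 < cmod (g p z - of_real (\<xi> p))"
    using flow_avoids_driving[of z p] domain_antimono[OF assms(1)] p by auto
  with min that show thesis by blast
qed

text \<open>The trajectory of \<open>z\<close> keeps a distance \<open>c\<close> from the driving function up to time \<open>t\<close>. While a
  second trajectory stays within \<open>c / 2\<close> of it, the exponential bound on the difference is valid
  and keeps it within \<open>c / 4\<close>; hence it never leaves, and in particular it survives.\<close>

lemma flow_stable:
  assumes z: "z \<in> H t" and "0 \<le> t"
  obtains d c C where "0 < d" "0 < c" "0 \<le> C"
    "\<And>z'. cmod (z' - z) < d \<Longrightarrow> z' \<in> H t"
    "\<And>z' r. cmod (z' - z) < d \<Longrightarrow> r \<in> {0..t} \<Longrightarrow> c \<le> cmod (g r z' - of_real (\<xi> r))"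
    "\<And>z' r. cmod (z' - z) < d \<Longrightarrow> r \<in> {0..t} \<Longrightarrow> cmod (g r z' - g r z) \<le> C * cmod (z' - z)"
proof -
  obtain c where c: "0 < c" "\<And>r. r \<in> {0..t} \<Longrightarrow> c \<le> cmod (g r z - of_real (\<xi> r))"
    using flow_distance_to_driving[OF assms] by blast
  define C where "C = exp (2 * t / (c\<^sup>2 / 2))"
  have "1 \<le> C" using \<open>0 \<le> t\<close> by (simp add: C_def)
  define d where "d = min (Im z) (c / (4 * C))"
  have "0 < Im z" using z by (simp add: mem_domain)
  have "0 < d" using \<open>0 < Im z\<close> \<open>0 < c\<close> \<open>1 \<le> C\<close> by (auto simp: d_def)
  have close: "cmod (g s z' - g s z) \<le> C * cmod (z' - z)"
    if s: "s \<in> {0..t}" and z': "z' \<in> H s" and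
       near: "\<And>r. r \<in> {0..s} \<Longrightarrow> cmod (g r z' - g r z) \<le> c / 2" for s z'
  proof -
    have "cmod (g s z' - g s z) \<le> cmod (z' - z) * exp (2 * s / (c\<^sup>2 / 2))"
    proof (rule flow_difference_bound)
      fix r assume r: "r \<in> {0..s}"
      have "c / 2 \<le> cmod (g r z' - of_real (\<xi> r))"
        using near[OF r] c(2)[of r] r s norm_triangle_sub[of "g r z - of_real (\<xi> r)" "g r z' - of_real (\<xi> r)"]
        by (auto simp: norm_minus_commute)
      moreover have "c \<le> cmod (g r z - of_real (\<xi> r))" using c(2)[of r] r s by simp
      ultimately have "c / 2 * c \<le> cmod (g r z' - of_real (\<xi> r)) * cmod (g r z - of_real (\<xi> r))"
        using \<open>0 < c\<close> by (intro mult_mono) auto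
      then show "c\<^sup>2 / 2 \<le> cmod (g r z' - of_real (\<xi> r)) * cmod (g r z - of_real (\<xi> r))"
        by (simp add: power2_eq_square)
    qed (use s z' c(1) domain_antimono[OF z] in auto)
    also have "\<dots> \<le> cmod (z' - z) * C"
      unfolding C_def using s \<open>0 < c\<close> by (intro mult_left_mono) (auto simp: divide_right_mono)
    finally show ?thesis by (simp add: mult.commute)
  qed
  have near: "cmod (g s z' - g s z) < c / 2"
    if z'd: "cmod (z' - z) < d" and s: "s \<in> {0..t}" and z': "z' \<in> H s" for s z'
  proof (rule bootstrap[where \<phi> = "\<lambda>r. cmod (g r z' - g r z)" and a = 0 and b = s])
    have zs: "z \<in> H s" using domain_antimono[OF z] s by simp
    show "continuous_on {0..s} (\<lambda>r. cmod (g r z' - g r z))"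
      by (intro continuous_intros flow_continuous z' zs) auto
    have small: "C * cmod (z' - z) < c / 4"
      using z'd \<open>1 \<le> C\<close> by (simp add: d_def field_simps)
    have "cmod (z' - z) \<le> C * cmod (z' - z)"
      using mult_right_mono[OF \<open>1 \<le> C\<close>, of "cmod (z' - z)"] by simp
    then show "cmod (g 0 z' - g 0 z) < c / 2"
      using small z' zs \<open>0 < c\<close> by (simp add: flow_initial mem_domain)
    show "cmod (g r z' - g r z) < c / 2"
      if "0 \<le> r" "r \<le> s" "\<And>q. 0 \<le> q \<Longrightarrow> q \<le> r \<Longrightarrow> cmod (g q z' - g q z) \<le> c / 2" for r
      using close[of r z'] that s small domain_antimono[OF z' \<open>r \<le> s\<close>] \<open>0 < c\<close>
      by force
  qed (use s in auto)
  have away: "c / 2 \<le> cmod (g r z' - of_real (\<xi> r))"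
    if "cmod (z' - z) < d" "r \<in> {0..t}" "z' \<in> H r" for r z'
    using near[OF that] c(2)[OF that(2)] norm_triangle_sub[of "g r z - of_real (\<xi> r)" "g r z' - of_real (\<xi> r)"]
    by (auto simp: norm_minus_commute)
  have inH: "z' \<in> H t" if "cmod (z' - z) < d" for z'
  proof (rule survives_if_away[of z' "c / 2"])
    have "\<bar>Im (z' - z)\<bar> < Im z"
      using abs_Im_le_cmod[of "z' - z"] that by (simp add: d_def)
    then show "0 < Im z'" by simp
  qed (use away[OF that] \<open>0 < c\<close> in auto)
  show thesis
  proof (rule that[of d "c / 2" C])
    show "cmod (g r z' - g r z) \<le> C * cmod (z' - z)" if "cmod (z' - z) < d" "r \<in> {0..t}" for z' r
    proof (rule close[OF that(2)])
      show "z' \<in> H r" using domain_antimono[OF inH[OF that(1)], of r] that(2) by simp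
      show "cmod (g q z' - g q z) \<le> c / 2" if "q \<in> {0..r}" for q
        using near[OF \<open>cmod (z' - z) < d\<close>, of q] domain_antimono[OF inH[OF \<open>cmod (z' - z) < d\<close>], of q]
          that \<open>r \<in> {0..t}\<close> by auto
    qed
    show "c / 2 \<le> cmod (g r z' - of_real (\<xi> r))" if "cmod (z' - z) < d" "r \<in> {0..t}" for z' r
      using away[OF that] domain_antimono[OF inH[OF that(1)], of r] that(2) by simp
  qed (use inH \<open>0 < d\<close> \<open>0 < c\<close> \<open>1 \<le> C\<close> in auto)
qed

lemma domain_open: "0 \<le> t \<Longrightarrow> open (H t)"
  unfolding open_dist dist_norm
proof
  fix z assume "0 \<le> t" "z \<in> H t"
  then show "\<exists>e>0. \<forall>y. norm (y - z) < e \<longrightarrow> y \<in> H t"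
    by (metis flow_stable)
qed

lemma flow_injective: "0 \<le> t \<Longrightarrow> inj_on (g t) (H t)"
proof (rule inj_onI)
  fix z z' assume "0 \<le> t" "z \<in> H t" "z' \<in> H t" "g t z = g t z'"
  then show "z = z'" using flow_difference[of z t z'] by simp
qed

text \<open>In \<open>flow_difference\<close> the difference quotient is the exponential of an integral that depends
  continuously on the second point.\<close>

lemma flow_has_field_derivative:
  assumes z: "z \<in> H t" and "0 \<le> t"
  shows "(g t has_field_derivative
    exp (integral {0..t} (\<lambda>r. - 2 / ((g r z - of_real (\<xi> r)) * (g r z - of_real (\<xi> r)))))) (at z)"
proof -
  define a where "a = (\<lambda>w r. - 2 / ((g r w - of_real (\<xi> r)) * (g r z - of_real (\<xi> r))))"
  define E where "E = (\<lambda>w. integral {0..t} (a w))"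
  obtain d c C where dcC: "0 < d" "0 < c" "0 \<le> C"
    and inH: "\<And>w. cmod (w - z) < d \<Longrightarrow> w \<in> H t"
    and away: "\<And>w r. cmod (w - z) < d \<Longrightarrow> r \<in> {0..t} \<Longrightarrow> c \<le> cmod (g r w - of_real (\<xi> r))"
    and lip: "\<And>w r. cmod (w - z) < d \<Longrightarrow> r \<in> {0..t} \<Longrightarrow> cmod (g r w - g r z) \<le> C * cmod (w - z)"
    using flow_stable[OF assms] by blast
  have ne: "g r w - of_real (\<xi> r) \<noteq> 0" if "cmod (w - z) < d" "r \<in> {0..t}" for w r
    using away[OF that] \<open>0 < c\<close> by auto
  have cont: "continuous_on {0..t} (a w)" if "cmod (w - z) < d" for w
    unfolding a_def
    by (intro continuous_intros flow_continuous driving_continuous' z inH[OF that])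
       (use ne[OF that] ne[of z] \<open>0 < d\<close> in auto)
  have bound: "cmod (E w - E z) \<le> 2 * C / c ^ 3 * t * cmod (w - z)" if w: "cmod (w - z) < d" for w
  proof -
    have "E w - E z = integral {0..t} (\<lambda>r. a w r - a z r)"
      unfolding E_def using cont[OF w] cont[of z] \<open>0 < d\<close>
      by (intro integral_diff[symmetric] integrable_continuous_interval) auto
    also have "cmod \<dots> \<le> 2 * C / c ^ 3 * cmod (w - z) * (t - 0)"
    proof (rule integral_bound)
      show "continuous_on {0..t} (\<lambda>r. a w r - a z r)"
        using cont[OF w] cont[of z] \<open>0 < d\<close> by (intro continuous_intros) auto
      fix r assume r: "r \<in> {0..t}"
      define x y where "x = g r w - of_real (\<xi> r)" and "y = g r z - of_real (\<xi> r)"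
      have x: "c \<le> cmod x" and y: "c \<le> cmod y"
        using away[OF w r] away[of z r] r \<open>0 < d\<close> by (auto simp: x_def y_def)
      then have "x \<noteq> 0" "y \<noteq> 0" using \<open>0 < c\<close> by auto
      then have "a w r - a z r = 2 * (x - y) / (x * (y * y))"
        unfolding a_def x_def[symmetric] y_def[symmetric] by (simp add: field_simps)
      also have "cmod \<dots> = 2 * cmod (x - y) / (cmod x * (cmod y * cmod y))"
        by (simp only: norm_mult norm_divide norm_numeral)
      also have "\<dots> \<le> 2 * (C * cmod (w - z)) / (c * (c * c))"
        using lip[OF w r] x y \<open>0 < c\<close> by (intro frac_le mult_mono) (auto simp: x_def y_def dcC less_imp_le)
      finally show "cmod (a w r - a z r) \<le> 2 * C / c ^ 3 * cmod (w - z)"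
        by (simp add: power3_eq_cube mult.assoc)
    qed fact
    finally show ?thesis by (simp add: mult_ac)
  qed
  have "(E \<longlongrightarrow> E z) (at z)"
  proof (rule Lim_null_comparison[THEN LIM_zero_cancel])
    show "\<forall>\<^sub>F w in at z. norm (E w - E z) \<le> 2 * C / c ^ 3 * t * cmod (w - z)"
      using bound \<open>0 < d\<close> by (auto simp: eventually_at dist_norm)
    show "((\<lambda>w. 2 * C / c ^ 3 * t * cmod (w - z)) \<longlongrightarrow> 0) (at z)"
      by (intro tendsto_mult_right_zero tendsto_norm_zero LIM_zero tendsto_ident_at)
  qed
  then have "((\<lambda>w. exp (E w)) \<longlongrightarrow> exp (E z)) (at z)"
    by (rule tendsto_exp)
  moreover have "\<forall>\<^sub>F w in at z. exp (E w) = (g t w - g t z) / (w - z)"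
    using flow_difference[OF inH z \<open>0 \<le> t\<close>] \<open>0 < d\<close>
    by (auto simp: eventually_at dist_norm E_def a_def)
  ultimately have "((\<lambda>w. (g t w - g t z) / (w - z)) \<longlongrightarrow> exp (E z)) (at z)"
    by (rule Lim_transform_eventually)
  then show ?thesis
    by (simp add: has_field_derivative_iff E_def a_def)
qed

lemma flow_holomorphic: "0 \<le> t \<Longrightarrow> g t holomorphic_on H t"
  by (rule holomorphic_onI)
     (use flow_has_field_derivative field_differentiable_at_within field_differentiable_def in blast)

text \<open>The interval \<open>[s, t]\<close> is negligible at scale \<open>R\<close>: the driving function oscillates by at most \<open>R / 4\<close>,
  and a trajectory at distance at least \<open>R / 2\<close> from it, having speed at most \<open>4 / R\<close>, moves by less than \<open>R / 4\<close>.\<close>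

definition calm :: "real \<Rightarrow> real \<Rightarrow> real \<Rightarrow> bool" where
  "calm s t R \<longleftrightarrow> 0 \<le> s \<and> s \<le> t \<and> 0 < R \<and> 16 * (t - s) < R\<^sup>2 \<and> (\<forall>r\<in>{s..t}. \<bar>\<xi> r - \<xi> s\<bar> \<le> R / 4)"

lemma calm_0:
  assumes "0 \<le> t"
  obtains R\<^sub>0 where "\<And>R. R\<^sub>0 \<le> R \<Longrightarrow> calm 0 t R"
proof -
  have "bounded (\<xi> ` {0..t})"
    using compact_imp_bounded[OF compact_continuous_image[OF driving_continuous' compact_Icc]] by simp
  then obtain M where M: "\<And>r. r \<in> {0..t} \<Longrightarrow> \<bar>\<xi> r\<bar> \<le> M"
    unfolding bounded_iff real_norm_def by blast
  \<comment> \<open>The oscillation is at most \<open>2 M \<le> R / 4\<close>, and \<open>16 t < R \<le> R\<^sup>2\<close> because \<open>R \<ge> 1\<close>.\<close>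
  have "calm 0 t R" if R: "8 * M + 16 * t + 1 \<le> R" for R
  proof -
    have M0: "\<bar>\<xi> 0\<bar> \<le> M" using M[of 0] \<open>0 \<le> t\<close> by simp
    then have "0 \<le> M" by linarith
    then have "1 \<le> R" "16 * t < R" using R \<open>0 \<le> t\<close> by auto
    moreover have "R \<le> R\<^sup>2" using \<open>1 \<le> R\<close> by (simp add: self_le_power)
    moreover have "\<bar>\<xi> r - \<xi> 0\<bar> \<le> R / 4" if "r \<in> {0..t}" for r
      using M[OF that] M0 \<open>0 \<le> t\<close> R by linarith
    ultimately show ?thesis using \<open>0 \<le> t\<close> by (simp add: calm_def)
  qed
  with that show thesis by blast
qed

lemma calm_before:
  assumes "0 < t" "0 < R"
  obtains s where "0 \<le> s" "s < t" "calm s t R"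
proof -
  have "isCont \<xi> t"
    using driving_continuous \<open>0 < t\<close>
    by (simp add: continuous_on_interior[of "{0..}"] interior_real_atLeast)
  then obtain d where d: "0 < d" "\<And>r. \<bar>r - t\<bar> < d \<Longrightarrow> \<bar>\<xi> r - \<xi> t\<bar> < R / 8"
    using \<open>0 < R\<close> unfolding continuous_at_eps_delta dist_real_def by (metis divide_pos_pos zero_less_numeral)
  define h where "h = min (t / 2) (min (d / 2) (R\<^sup>2 / 32))"
  have h: "0 < h" "h < t" "h < d" "16 * h < R\<^sup>2"
    using assms \<open>0 < d\<close> by (auto simp: h_def min_def)
  have "\<bar>\<xi> r - \<xi> (t - h)\<bar> \<le> R / 4" if "r \<in> {t - h..t}" for r
    proof -
    have "\<bar>r - t\<bar> < d" "\<bar>t - h - t\<bar> < d" using that h by auto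
    then show ?thesis using d(2)[of r] d(2)[of "t - h"] by linarith
  qed
  then have "calm (t - h) t R"
    using h assms by (simp add: calm_def)
  with h that[of "t - h"] show thesis by simp
qed

lemma flow_displacement:
  assumes z: "z \<in> H b" and "0 \<le> a" "a \<le> b" "0 < m"
    and away: "\<And>r. r \<in> {a..b} \<Longrightarrow> m \<le> cmod (g r z - of_real (\<xi> r))"
  shows "cmod (g b z - g a z) \<le> 2 / m * (b - a)"
proof (rule displacement_bound[OF \<open>a \<le> b\<close>])
  fix r assume r: "r \<in> {a..b}"
  show "((\<lambda>r. g r z) has_vector_derivative 2 / (g r z - of_real (\<xi> r))) (at r within {a..b})"
    by (rule flow_deriv) (use assms r in auto)
  show "cmod (2 / (g r z - of_real (\<xi> r))) \<le> 2 / m"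
    using away[OF r] \<open>0 < m\<close> by (auto simp: norm_divide intro: frac_le)
qed

lemma calm_displacement:
  assumes "calm s t R" and z: "z \<in> H b" and "s \<le> a" "a \<le> b" "b \<le> t"
    and away: "\<And>r. r \<in> {a..b} \<Longrightarrow> R / 2 \<le> cmod (g r z - of_real (\<xi> r))"
  shows "cmod (g b z - g a z) < R / 4"
proof -
  have calm: "0 \<le> s" "0 < R" "16 * (t - s) < R\<^sup>2" using assms by (auto simp: calm_def)
  have "cmod (g b z - g a z) \<le> 2 / (R / 2) * (b - a)"
    by (rule flow_displacement) (use assms calm in auto)
  also have "\<dots> \<le> 4 / R * (t - s)"
    using assms calm by (auto simp: divide_right_mono)
  also have "\<dots> < R / 4" using calm by (simp add: field_simps power2_eq_square)
  finally show ?thesis .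
qed

text \<open>As long as the displacement is at most \<open>R / 4\<close>, the distance to the driving function is at least
  \<open>R - R / 4 - R / 4\<close>, and then the displacement is even less than \<open>R / 4\<close>.\<close>

lemma far_points_barely_move:
  assumes calm: "calm s t R" and z: "z \<in> H s" and far: "R \<le> cmod (g s z - of_real (\<xi> s))"
  shows "z \<in> H t" and "cmod (g t z - g s z) < R / 4"
proof -
  have st: "0 \<le> s" "s \<le> t" "0 < R" and osc: "\<And>r. r \<in> {s..t} \<Longrightarrow> \<bar>\<xi> r - \<xi> s\<bar> \<le> R / 4"
    using calm by (auto simp: calm_def)
  have away: "R / 2 \<le> cmod (g r z - of_real (\<xi> r))"
    if r: "r \<in> {s..t}" and close: "cmod (g r z - g s z) \<le> R / 4" for r
  proof -
    have "g s z - of_real (\<xi> s) = (g r z - of_real (\<xi> r)) + (g s z - g r z) + of_real (\<xi> r - \<xi> s)"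
      by simp
    also have "cmod \<dots> \<le> cmod (g r z - of_real (\<xi> r)) + cmod (g s z - g r z) + \<bar>\<xi> r - \<xi> s\<bar>"
      by (intro norm_triangle_le add_mono order_refl norm_triangle_ineq) (simp add: norm_of_real del: of_real_diff)
    finally show ?thesis using far osc[OF r] close by (simp add: norm_minus_commute)
  qed
  have close: "cmod (g r z - g s z) < R / 4" if r: "r \<in> {s..t}" and zr: "z \<in> H r" for r
  proof (rule bootstrap[where \<phi> = "\<lambda>r. cmod (g r z - g s z)" and a = s and b = r])
    show "continuous_on {s..r} (\<lambda>r. cmod (g r z - g s z))"
      by (intro continuous_intros flow_continuous zr st)
    show "cmod (g p z - g s z) < R / 4"
      if p: "s \<le> p" "p \<le> r" "\<And>q. s \<le> q \<Longrightarrow> q \<le> p \<Longrightarrow> cmod (g q z - g s z) \<le> R / 4" for p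
      by (rule calm_displacement[OF calm domain_antimono[OF zr p(2)]])
         (use p r away in auto)
  qed (use r \<open>0 < R\<close> in auto)
  obtain c where c: "0 < c" "\<And>r. r \<in> {0..s} \<Longrightarrow> c \<le> cmod (g r z - of_real (\<xi> r))"
    using flow_distance_to_driving[OF z \<open>0 \<le> s\<close>] by blast
  show zt: "z \<in> H t"
  proof (rule survives_if_away[of z "min c (R / 2)"])
    show "min c (R / 2) \<le> cmod (g r z - of_real (\<xi> r))" if "0 \<le> r" "r \<le> t" "z \<in> H r" for r
    proof (cases "r \<le> s")
      case True
      then show ?thesis using c(2)[of r] that by simp
    next
      case False
      then show ?thesis using close[of r] away[of r] that by auto
    qed
  qed (use z c \<open>0 < R\<close> in \<open>auto simp: mem_domain\<close>)
  show "cmod (g t z - g s z) < R / 4" using close[of t] zt st by simp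
qed

text \<open>The bound for far points run backwards in time: a point that is far from the driving function at
  time \<open>t\<close> was far from it at time \<open>s\<close> already.\<close>

lemma near_points_stay_near:
  assumes calm: "calm s t R" and z: "z \<in> H t" and near: "cmod (g s z - of_real (\<xi> s)) < R"
  shows "cmod (g t z - of_real (\<xi> t)) < 3 * R"
proof (rule ccontr)
  assume "\<not> ?thesis"
  then have far: "3 * R \<le> cmod (g t z - of_real (\<xi> t))" by simp
  have st: "0 \<le> s" "s \<le> t" "0 < R" and osc: "\<And>r. r \<in> {s..t} \<Longrightarrow> \<bar>\<xi> r - \<xi> s\<bar> \<le> R / 4"
    using calm by (auto simp: calm_def)
  have away: "2 * R \<le> cmod (g r z - of_real (\<xi> r))"
    if r: "r \<in> {s..t}" and close: "cmod (g t z - g r z) \<le> R / 4" for r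
  proof -
    have "g t z - of_real (\<xi> t) = (g r z - of_real (\<xi> r)) + (g t z - g r z) + of_real (\<xi> r - \<xi> t)"
      by simp
    also have "cmod \<dots> \<le> cmod (g r z - of_real (\<xi> r)) + cmod (g t z - g r z) + \<bar>\<xi> r - \<xi> t\<bar>"
      by (intro norm_triangle_le add_mono order_refl norm_triangle_ineq) (simp add: norm_of_real del: of_real_diff)
    finally show ?thesis
      using far osc[OF r] osc[of t, unfolded atLeastAtMost_iff, OF conjI[OF st(2) order_refl]] close
      by linarith
  qed
  have close: "cmod (g t z - g (t - r) z) < R / 4" if "0 \<le> r" "r \<le> t - s" for r
  proof (rule bootstrap[where \<phi> = "\<lambda>r. cmod (g t z - g (t - r) z)" and a = 0 and b = "t - s"])
    have "continuous_on {0..t - s} (\<lambda>r. g (t - r) z)"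
      by (rule continuous_on_compose2[OF flow_continuous[OF z \<open>0 \<le> s\<close>]])
         (auto intro!: continuous_intros)
    then show "continuous_on {0..t - s} (\<lambda>r. cmod (g t z - g (t - r) z))"
      by (intro continuous_intros)
    show "cmod (g t z - g (t - p) z) < R / 4"
      if p: "0 \<le> p" "p \<le> t - s" "\<And>q. 0 \<le> q \<Longrightarrow> q \<le> p \<Longrightarrow> cmod (g t z - g (t - q) z) \<le> R / 4" for p
    proof (rule calm_displacement[OF calm z])
      show "R / 2 \<le> cmod (g r z - of_real (\<xi> r))" if "r \<in> {t - p..t}" for r
        using away[of r] p(3)[of "t - r"] p(1,2) that \<open>0 < R\<close> by auto
    qed (use p in auto)
  qed (use that \<open>0 < R\<close> in auto)
  show False
    using close[of "t - s"] away[of s] near st by auto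
qed

lemma absorbed_points_near:
  assumes "calm s t R" "z \<in> H s" "z \<notin> H t"
  shows "cmod (g s z - of_real (\<xi> s)) < R"
  using far_points_barely_move(1)[OF assms(1,2)] assms(3) by force

text \<open>At a time \<open>s\<close> shortly before \<open>\<sigma>\<close> the point \<open>z\<close> is absorbed within a calm interval, so \<open>g s z\<close> is near
  \<open>\<xi> s\<close>. The map \<open>g s\<close> is continuous at \<open>z\<close>, so the same holds for all \<open>w\<close> close to \<open>z\<close>, and those that
  survive until \<open>\<sigma>\<close> stay near the driving function.\<close>

lemma flow_tends_to_driving:
  assumes "0 < Im z" "\<tau> z = ereal \<sigma>" "0 < \<sigma>"
  shows "(g \<sigma> \<longlongrightarrow> of_real (\<xi> \<sigma>)) (at z within H \<sigma>)"
proof (rule tendstoI)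
  fix e :: real assume "0 < e"
  obtain s where s: "0 \<le> s" "s < \<sigma>" "calm s \<sigma> (e / 3)"
    using calm_before[of \<sigma> "e / 3"] assms \<open>0 < e\<close> by auto
  have zs: "z \<in> H s" using assms s by (simp add: mem_domain)
  then have "cmod (g s z - of_real (\<xi> s)) < e / 3"
    using absorbed_points_near[OF s(3)] assms by (simp add: mem_domain)
  moreover have "isCont (g s) z"
    using flow_has_field_derivative[OF zs \<open>0 \<le> s\<close>] by (rule DERIV_isCont)
  ultimately have "\<forall>\<^sub>F w in at z. cmod (g s w - of_real (\<xi> s)) < e / 3"
    by (intro order_tendstoD) (auto intro!: tendsto_intros simp: isCont_def)
  then have "\<forall>\<^sub>F w in at z within H \<sigma>. cmod (g s w - of_real (\<xi> s)) < e / 3"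
    by (rule filter_leD[OF at_le[OF subset_UNIV]])
  moreover have "\<forall>\<^sub>F w in at z within H \<sigma>. w \<in> H \<sigma>"
    by (simp add: eventually_at_filter)
  ultimately show "\<forall>\<^sub>F w in at z within H \<sigma>. dist (g \<sigma> w) (of_real (\<xi> \<sigma>)) < e"
  proof eventually_elim
    case (elim w)
    then show ?case using near_points_stay_near[OF s(3), of w] by (simp add: dist_norm)
  qed
qed

lemma flow_moves_little_far_away:
  assumes "0 \<le> t"
  obtains R where "0 < R"
    "\<And>z. 0 < Im z \<Longrightarrow> R \<le> cmod (z - of_real (\<xi> 0)) \<Longrightarrow> z \<in> H t"
    "\<And>z. 0 < Im z \<Longrightarrow> R \<le> cmod (z - of_real (\<xi> 0)) \<Longrightarrow> cmod (g t z - z) < cmod (z - of_real (\<xi> 0)) / 4"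
proof -
  obtain R where R: "\<And>R'. R \<le> R' \<Longrightarrow> calm 0 t R'"
    using calm_0[OF assms] by blast
  have far: "z \<in> H t \<and> cmod (g t z - z) < cmod (z - of_real (\<xi> 0)) / 4"
    if "0 < Im z" "R \<le> cmod (z - of_real (\<xi> 0))" for z
    using far_points_barely_move[OF R[OF that(2)], of z] that(1) domain_0
    by (simp add: flow_initial)
  show thesis by (rule that[of R]) (use far R[of R] in \<open>auto simp: calm_def\<close>)
qed

text \<open>A point far from \<open>\<xi> 0\<close> moves by less than a quarter of its distance to \<open>\<xi> 0\<close>, hence cannot have a
  small image.\<close>

lemma flow_preimages_bounded:
  assumes "0 \<le> t"
  obtains B where "\<And>z. z \<in> H t \<Longrightarrow> cmod (g t z) \<le> M \<Longrightarrow> cmod z \<le> B"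
proof -
  obtain R where R: "0 < R" "\<And>z. 0 < Im z \<Longrightarrow> R \<le> cmod (z - of_real (\<xi> 0)) \<Longrightarrow>
      cmod (g t z - z) < cmod (z - of_real (\<xi> 0)) / 4"
    using flow_moves_little_far_away[OF assms] by metis
  have "cmod z \<le> max (R + \<bar>\<xi> 0\<bar>) (2 * M + 4 * \<bar>\<xi> 0\<bar>)" if z: "z \<in> H t" "cmod (g t z) \<le> M" for z
  proof -
    have tri: "cmod z \<le> cmod (z - of_real (\<xi> 0)) + \<bar>\<xi> 0\<bar>"
              "cmod (z - of_real (\<xi> 0)) \<le> cmod z + \<bar>\<xi> 0\<bar>"
              "cmod z \<le> cmod (g t z) + cmod (g t z - z)"
      using norm_triangle_ineq[of "z - of_real (\<xi> 0)" "of_real (\<xi> 0)"]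
        norm_triangle_ineq4[of z "of_real (\<xi> 0)"] norm_triangle_ineq4[of "g t z" "g t z - z"]
      by auto
    show ?thesis
    proof (cases "R \<le> cmod (z - of_real (\<xi> 0))")
      case True
      then have "cmod (g t z - z) < cmod (z - of_real (\<xi> 0)) / 4"
        using R(2) z by (simp add: mem_domain)
      then show ?thesis using tri z norm_ge_zero[of "g t z"] by linarith
    qed (use tri in linarith)
  qed
  with that show thesis by blast
qed

lemma flow_continuous_on_domain: "0 \<le> t \<Longrightarrow> continuous_on (H t) (g t)"
  by (intro holomorphic_on_imp_continuous_on flow_holomorphic)

lemma flow_isCont: "0 \<le> t \<Longrightarrow> z \<in> H t \<Longrightarrow> isCont (g t) z"
  using flow_has_field_derivative by (blast intro: DERIV_isCont)

text \<open>Surjectivity of \<open>g t\<close> is obtained without solving the equation backwards. If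
  \<open>g t (z n) \<longlonglongrightarrow> w\<close>, the points \<open>z n\<close> are bounded and subconverge to some \<open>l\<close>. Imaginary parts decrease
  along trajectories, so those of \<open>z n\<close> stay above \<open>Im w\<close> in the limit; as long as the trajectory of
  \<open>l\<close> lives, it inherits this bound, which keeps it away from the real driving function.\<close>

lemma flow_range_closed:
  assumes "0 \<le> t" and w: "w \<in> closure (g t ` H t)" "0 < Im w"
  shows "w \<in> g t ` H t"
proof -
  obtain x where x: "\<And>n. x n \<in> g t ` H t" "x \<longlonglongrightarrow> w"
    using w(1) unfolding closure_sequential by auto
  then obtain z where z: "\<And>n. z n \<in> H t" "\<And>n. g t (z n) = x n"
    unfolding image_iff by metis
  obtain M where M: "\<And>n. cmod (x n) \<le> M"
    using convergent_imp_bounded[OF x(2)] by (auto simp: bounded_iff)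
  obtain B where "\<And>z. z \<in> H t \<Longrightarrow> cmod (g t z) \<le> M \<Longrightarrow> cmod z \<le> B"
    using flow_preimages_bounded[OF \<open>0 \<le> t\<close>] by blast
  then have "\<And>n. z n \<in> cball 0 B" using z M by simp
  then obtain l r where lr: "strict_mono (r :: nat \<Rightarrow> nat)" "(z \<circ> r) \<longlonglongrightarrow> l"
    using compact_imp_seq_compact[OF compact_cball[of "0::complex" B]]
    by (metis seq_compactE)
  have xr: "(\<lambda>n. x (r n)) \<longlonglongrightarrow> w"
    using LIMSEQ_subseq_LIMSEQ[OF x(2) lr(1)] by (simp add: o_def)
  have zr: "(\<lambda>n. z (r n)) \<longlonglongrightarrow> l" using lr(2) by (simp add: o_def)
  have Im_limit: "Im w \<le> Im (g s l)"
    if s: "0 \<le> s" "s \<le> t" and cont: "isCont (g s) l" for s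
  proof (rule LIMSEQ_le)
    show "(\<lambda>n. Im (x (r n))) \<longlonglongrightarrow> Im w" by (intro tendsto_intros xr)
    show "(\<lambda>n. Im (g s (z (r n)))) \<longlonglongrightarrow> Im (g s l)"
      by (intro tendsto_intros isCont_tendsto_compose[OF cont] zr)
    show "\<exists>N. \<forall>n\<ge>N. Im (x (r n)) \<le> Im (g s (z (r n)))"
      using Im_flow_antimono[OF z(1) s] z(2) by metis
  qed
  have "Im w \<le> Im l"
  proof (rule LIMSEQ_le)
    show "(\<lambda>n. Im (x (r n))) \<longlonglongrightarrow> Im w" by (intro tendsto_intros xr)
    show "(\<lambda>n. Im (z (r n))) \<longlonglongrightarrow> Im l" by (intro tendsto_intros zr)
    show "\<exists>N. \<forall>n\<ge>N. Im (x (r n)) \<le> Im (z (r n))"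
      using Im_flow_antimono[OF z(1) order_refl \<open>0 \<le> t\<close>] z by (simp add: flow_initial mem_domain)
  qed
  have l: "l \<in> H t"
  proof (rule survives_if_away)
    show "0 < Im l" using \<open>Im w \<le> Im l\<close> w(2) by simp
    show "0 < Im w" by fact
    fix s assume s: "0 \<le> s" "s \<le> t" "l \<in> H s"
    have "Im w \<le> Im (g s l - of_real (\<xi> s))"
      using Im_limit[OF s(1,2) flow_isCont] s by simp
    then show "Im w \<le> cmod (g s l - of_real (\<xi> s))"
      using abs_Im_le_cmod[of "g s l - of_real (\<xi> s)"] by linarith
  qed
  have "(\<lambda>n. g t (z (r n))) \<longlonglongrightarrow> g t l"
    by (intro isCont_tendsto_compose[OF flow_isCont] zr l \<open>0 \<le> t\<close>)
  then have "g t l = w" using xr z(2) LIMSEQ_unique by auto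
  with l show ?thesis by blast
qed

lemma upper_half_plane_convex: "convex upper_half_plane"
  by (rule convex_halfspace_Im_gt)

lemma upper_half_plane_open: "open upper_half_plane"
  by (rule open_halfspace_Im_gt)

text \<open>The image is open by injectivity, relatively closed, and not empty; the half plane is connected.\<close>

lemma flow_surjective:
  assumes "0 \<le> t"
  shows "g t ` H t = upper_half_plane"
proof -
  let ?I = "g t ` H t"
  have sub: "?I \<subseteq> upper_half_plane" using Im_flow_pos \<open>0 \<le> t\<close> by auto
  have "open ?I"
    using open_mapping_thm3 flow_holomorphic domain_open flow_injective \<open>0 \<le> t\<close> by blast
  then have "openin (top_of_set upper_half_plane) ?I"
    using sub by (simp add: open_openin_trans upper_half_plane_open openin_open_eq)
  moreover have "closedin (top_of_set upper_half_plane) ?I"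
  proof -
    have "?I = upper_half_plane \<inter> closure ?I"
      using sub flow_range_closed[OF \<open>0 \<le> t\<close>] closure_subset[of ?I] by blast
    then show ?thesis using closedin_closed_Int[OF closed_closure] by metis
  qed
  moreover have "?I \<noteq> {}"
  proof -
    obtain R where R: "0 < R"
      "\<And>z. 0 < Im z \<Longrightarrow> R \<le> cmod (z - of_real (\<xi> 0)) \<Longrightarrow> z \<in> H t"
      using flow_moves_little_far_away[OF \<open>0 \<le> t\<close>] by metis
    have "of_real (\<xi> 0) + \<i> * of_real R \<in> H t" using R by (intro R(2)) (auto simp: norm_mult)
    then show ?thesis by blast
  qed
  ultimately show ?thesis
    using convex_connected[OF upper_half_plane_convex] unfolding connected_clopen by blast
qed

abbreviation f :: "real \<Rightarrow> complex \<Rightarrow> complex" where "f t \<equiv> loewner_inverse g \<tau> t"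

lemma inverse_in_domain: "0 \<le> t \<Longrightarrow> 0 < Im w \<Longrightarrow> f t w \<in> H t"
  and flow_inverse: "0 \<le> t \<Longrightarrow> 0 < Im w \<Longrightarrow> g t (f t w) = w"
  using flow_surjective[of t]
  by (auto simp: loewner_inverse_def inv_into_into f_inv_into_f)

lemma inverse_flow: "0 \<le> t \<Longrightarrow> z \<in> H t \<Longrightarrow> f t (g t z) = z"
  by (simp add: loewner_inverse_def flow_injective)

lemma inverse_image: "0 \<le> t \<Longrightarrow> f t ` upper_half_plane = H t"
  using inverse_in_domain Im_flow_pos
  by (auto intro!: image_eqI[where f = "f t", OF inverse_flow[symmetric]])

lemma inverse_injective: "0 \<le> t \<Longrightarrow> inj_on (f t) upper_half_plane"
  by (rule inj_on_inverseI[of _ "g t"]) (simp add: flow_inverse)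

lemma inverse_holomorphic:
  assumes "0 \<le> t"
  shows "f t holomorphic_on upper_half_plane"
proof -
  obtain h where h: "h holomorphic_on (g t ` H t)" "\<And>z. z \<in> H t \<Longrightarrow> h (g t z) = z"
    using holomorphic_has_inverse[OF flow_holomorphic domain_open flow_injective] assms by metis
  have "h w = f t w" if "w \<in> upper_half_plane" for w
    using h(2)[of "f t w"] that assms by (simp add: inverse_in_domain flow_inverse)
  with h(1) show ?thesis
    unfolding flow_surjective[OF assms] by (rule holomorphic_transform)
qed

lemma inverse_bounded:
  assumes "0 \<le> t" "bounded S" "S \<subseteq> upper_half_plane"
  shows "bounded (f t ` S)"
proof -
  obtain M where M: "\<And>w. w \<in> S \<Longrightarrow> cmod w \<le> M" using assms(2) by (auto simp: bounded_iff)
  obtain B where "\<And>z. z \<in> H t \<Longrightarrow> cmod (g t z) \<le> M \<Longrightarrow> cmod z \<le> B"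
    using flow_preimages_bounded[OF \<open>0 \<le> t\<close>] by blast
  then have "cmod (f t w) \<le> B" if "w \<in> S" for w
    using that M assms(1,3) by (auto simp: subset_iff inverse_in_domain flow_inverse)
  then show ?thesis by (auto simp: bounded_iff)
qed

lemma domain_connected: "0 \<le> t \<Longrightarrow> connected (H t)"
  using connected_continuous_image[OF holomorphic_on_imp_continuous_on[OF inverse_holomorphic]
      convex_connected[OF upper_half_plane_convex]] by (simp add: inverse_image)

end

section \<open>Short crosscuts of conformal maps\<close>

lemma sum_squared_radii_disjoint_balls:
  fixes b :: "'i \<Rightarrow> complex"
  assumes "finite I" and disj: "disjoint_family_on (\<lambda>i. ball (b i) (r i)) I"
    and r: "\<And>i. i \<in> I \<Longrightarrow> 0 \<le> r i" and sub: "\<And>i. i \<in> I \<Longrightarrow> ball (b i) (r i) \<subseteq> ball c B" and "0 \<le> B"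
  shows "(\<Sum>i\<in>I. (r i)\<^sup>2) \<le> B\<^sup>2"
proof -
  define V where "V = measure lborel (ball (0::complex) 1)"
  have "0 < V" unfolding V_def by (rule content_ball_pos) simp
  have area: "measure lborel (ball x s) = s\<^sup>2 * V" if "0 \<le> s" for x :: complex and s
    using content_ball_conv_unit_ball[OF that, of x] by (simp add: V_def)
  have "(\<Sum>i\<in>I. (r i)\<^sup>2) * V = (\<Sum>i\<in>I. measure lborel (ball (b i) (r i)))"
    using r by (simp add: area sum_distrib_right)
  also have "\<dots> = measure lborel (\<Union>i\<in>I. ball (b i) (r i))"
    using emeasure_lborel_ball_finite
    by (intro measure_finite_Union[symmetric] \<open>finite I\<close> disj) (auto simp: less_top)
  also have "\<dots> \<le> measure lborel (ball c B)"
    using sub \<open>finite I\<close> emeasure_lborel_ball_finite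
    by (intro measure_mono_fmeasurable) (auto intro!: fmeasurableI)
  also have "\<dots> = B\<^sup>2 * V" by (rule area) fact
  finally show ?thesis using \<open>0 < V\<close> by simp
qed

definition half_strip :: "complex set" where
  "half_strip = {\<zeta>. Re \<zeta> < 0 \<and> 0 < Im \<zeta> \<and> Im \<zeta> < pi}"

lemma open_half_strip: "open half_strip"
proof -
  have "half_strip = {\<zeta>. Re \<zeta> < 0} \<inter> {\<zeta>. Im \<zeta> > 0} \<inter> {\<zeta>. Im \<zeta> < pi}"
    by (auto simp: half_strip_def)
  moreover have "open \<dots>"
    by (intro open_Int open_halfspace_Re_lt open_halfspace_Im_gt open_halfspace_Im_lt)
  ultimately show ?thesis by simp
qed

definition grid_centre :: "real \<Rightarrow> real \<Rightarrow> nat \<Rightarrow> nat \<Rightarrow> complex" where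
  "grid_centre h v i j = Complex (- 1 - (real i + 1 / 2) * h) (v + (real j + 1 / 2) * h)"

lemma dist_grid_centre:
  assumes "0 < h" "(i, j) \<noteq> (i', j')"
  shows "h \<le> dist (grid_centre h v i j) (grid_centre h v i' j')"
proof -
  have gap: "h \<le> \<bar>(real k - real k') * h\<bar>" if "k \<noteq> k'" for k k' :: nat
  proof -
    have "1 \<le> \<bar>real k - real k'\<bar>" using that by linarith
    then show ?thesis using \<open>0 < h\<close> by (simp add: abs_mult)
  qed
  let ?d = "grid_centre h v i j - grid_centre h v i' j'"
  have "Re ?d = - ((real i - real i') * h)" "Im ?d = (real j - real j') * h"
    by (auto simp: grid_centre_def algebra_simps)
  then show ?thesis
    using assms gap[of i i'] gap[of j j'] abs_Re_le_cmod[of ?d] abs_Im_le_cmod[of ?d]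
    by (auto simp: dist_norm)
qed

text \<open>A discrete form of ``the integral of \<open>\<bar>F'\<bar>\<^sup>2\<close> is at most the area of the image''. Bloch's
  theorem, with its constant \<open>1 / 12\<close>, puts a disc of radius \<open>h / 2 * \<bar>F'\<bar> / 12\<close> into the image of the disc inscribed in
  each square; by injectivity these discs are disjoint.\<close>

lemma grid_derivative_sum_bound:
  assumes holF: "F holomorphic_on half_strip" and injF: "inj_on F half_strip"
    and FB: "F ` half_strip \<subseteq> ball c B" and "0 < h" "0 \<le> v" "v + real m * h \<le> pi"
  shows "(\<Sum>i<n. \<Sum>j<m. (h * cmod (deriv F (grid_centre h v i j)) / 24)\<^sup>2) \<le> B\<^sup>2"
proof -
  define I where "I = {..<n} \<times> {..<m}"
  define p where "p = (\<lambda>(i, j). grid_centre h v i j)"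
  define r where "r = (\<lambda>q. h / 2 * cmod (deriv F (p q)) / 12)"
  have square: "ball (p q) (h / 2) \<subseteq> half_strip" if q: "q \<in> I" for q
  proof
    fix \<zeta> assume \<zeta>: "\<zeta> \<in> ball (p q) (h / 2)"
    obtain i j where ij: "q = (i, j)" "i < n" "j < m" using q by (auto simp: I_def)
    have close: "\<bar>Re \<zeta> - Re (p q)\<bar> < h / 2" "\<bar>Im \<zeta> - Im (p q)\<bar> < h / 2"
      using \<zeta> abs_Re_le_cmod[of "\<zeta> - p q"] abs_Im_le_cmod[of "\<zeta> - p q"]
      by (auto simp: dist_norm norm_minus_commute)
    have "real j * h + h \<le> real m * h"
      using mult_right_mono[of "real j + 1" "real m" h] ij \<open>0 < h\<close> by (simp add: algebra_simps)
    moreover have "0 \<le> real j * h" "0 \<le> real i * h" using \<open>0 < h\<close> by auto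
    moreover have "Re (p q) = - 1 - real i * h - h / 2" "Im (p q) = v + real j * h + h / 2"
      by (auto simp: p_def ij grid_centre_def algebra_simps)
    ultimately have "Re \<zeta> < 0" "0 < Im \<zeta>" "Im \<zeta> < pi"
      using close \<open>0 < h\<close> \<open>0 \<le> v\<close> \<open>v + real m * h \<le> pi\<close> by linarith+
    then show "\<zeta> \<in> half_strip" by (simp add: half_strip_def)
  qed
  have "\<exists>b. ball b (r q) \<subseteq> F ` ball (p q) (h / 2)" if "q \<in> I" for q
    using Bloch[OF holomorphic_on_subset[OF holF square[OF that]], of "r q"] \<open>0 < h\<close>
    unfolding r_def by (metis half_gt_zero order_refl)
  then obtain b where b: "\<And>q. q \<in> I \<Longrightarrow> ball (b q) (r q) \<subseteq> F ` ball (p q) (h / 2)" by metis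
  have "(\<Sum>q\<in>I. (r q)\<^sup>2) \<le> B\<^sup>2"
  proof (rule sum_squared_radii_disjoint_balls)
    show "disjoint_family_on (\<lambda>q. ball (b q) (r q)) I"
      unfolding disjoint_family_on_def
    proof (intro ballI impI)
      fix q q' assume q: "q \<in> I" "q' \<in> I" "q \<noteq> q'"
      have "ball (p q) (h / 2) \<inter> ball (p q') (h / 2) = {}"
        using dist_grid_centre[OF \<open>0 < h\<close>, of "fst q" "snd q" "fst q'" "snd q'" v] q
        by (intro disjoint_ballI) (simp add: p_def case_prod_beta prod_eq_iff)
      then have "F ` ball (p q) (h / 2) \<inter> F ` ball (p q') (h / 2) = {}"
        using inj_on_image_Int[OF injF square[OF q(1)] square[OF q(2)]] by simp
      then show "ball (b q) (r q) \<inter> ball (b q') (r q') = {}" 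
        using b[OF q(1)] b[OF q(2)] by blast
    qed
    show "ball (b q) (r q) \<subseteq> ball c B" if "q \<in> I" for q
      using b[OF that] square[OF that] FB by blast
    have "Complex (- 1) 1 \<in> half_strip"
      using pi_gt3 by (simp add: half_strip_def)
    then have "ball c B \<noteq> {}" using FB by blast
    then show "0 \<le> B" by simp
  qed (use \<open>0 < h\<close> in \<open>auto simp: I_def r_def\<close>)
  then show ?thesis
    unfolding I_def sum.cartesian_product by (simp add: r_def p_def case_prod_beta)
qed

text \<open>The segment above \<open>u\<close> is cut into cells of height \<open>h\<close>, and \<open>a j\<close> bounds the derivative on the \<open>j\<close>-th
  cell.\<close>

lemma vertical_increment_bound:
  assumes derF: "\<And>y. v \<le> y \<Longrightarrow> y \<le> v + real m * h \<Longrightarrow> (F has_field_derivative F' (Complex u y)) (at (Complex u y))"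
    and osc: "\<And>j y. j < m \<Longrightarrow> v + real j * h \<le> y \<Longrightarrow> y \<le> v + (real j + 1) * h \<Longrightarrow> cmod (F' (Complex u y)) \<le> a j"
    and "0 < h" "k \<le> m" "v \<le> y" "y \<le> v + real k * h"
  shows "cmod (F (Complex u y) - F (Complex u v)) \<le> (\<Sum>j<k. a j * h)"
  using \<open>k \<le> m\<close> \<open>v \<le> y\<close> \<open>y \<le> v + real k * h\<close>
proof (induction k arbitrary: y)
  case 0
  then show ?case by simp
next
  case (Suc k)
  have "cmod (F' (Complex u (v + real k * h))) \<le> a k"
    using Suc.prems \<open>0 < h\<close> by (intro osc) (auto simp: algebra_simps)
  then have "0 \<le> a k" using norm_ge_zero order_trans by blast
  show ?case
  proof (cases "y \<le> v + real k * h")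
    case True
    then show ?thesis
      using Suc.IH[of y] Suc.prems mult_nonneg_nonneg[OF \<open>0 \<le> a k\<close>, of h] \<open>0 < h\<close> by simp
  next
    case False
    define v' where "v' = v + real k * h"
    have v': "v \<le> v'" "v' \<le> y" "y \<le> v' + h"
      using False Suc.prems \<open>0 < h\<close> by (auto simp: v'_def algebra_simps)
    have mh: "real (Suc k) * h \<le> real m * h" using Suc.prems \<open>0 < h\<close> by (intro mult_right_mono) auto
    have "cmod (F (Complex u y) - F (Complex u v')) \<le> a k * cmod (Complex u y - Complex u v')"
    proof (rule field_differentiable_bound[of "closed_segment (Complex u v') (Complex u y)"])
      fix z assume "z \<in> closed_segment (Complex u v') (Complex u y)"
      then obtain x where z: "z = Complex u x" and x: "v' \<le> x" "x \<le> y"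
        using v'(2) by (cases z) (auto simp: closed_segment_same_Re closed_segment_eq_real_ivl)
      show "(F has_field_derivative F' z) (at z within closed_segment (Complex u v') (Complex u y))"
        unfolding z using derF[of x] x v' mh Suc.prems by (auto intro: has_field_derivative_at_within)
      show "cmod (F' z) \<le> a k"
        unfolding z using osc[of k x] x v' Suc.prems by (auto simp: v'_def algebra_simps)
    qed auto
    also have "cmod (Complex u y - Complex u v') = y - v'"
      using v' by (simp add: cmod_def)
    also have "a k * (y - v') \<le> a k * h" using v' \<open>0 \<le> a k\<close> by (intro mult_left_mono) auto
    finally have "cmod (F (Complex u y) - F (Complex u v')) \<le> a k * h" .
    moreover have "cmod (F (Complex u v') - F (Complex u v)) \<le> (\<Sum>j<k. a j * h)"
      using Suc v' by (auto simp: v'_def)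
    moreover have "cmod (F (Complex u y) - F (Complex u v)) \<le>
      cmod (F (Complex u y) - F (Complex u v')) + cmod (F (Complex u v') - F (Complex u v))"
      by (metis diff_add_cancel diff_add_eq add_diff_eq norm_triangle_ineq)
    ultimately show ?thesis by simp
  qed
qed

text \<open>The two heights at which a large increment is seen depend on \<open>u\<close>, but by continuity they also
  serve for all nearby \<open>u\<close>. By compactness they can be kept at a fixed distance \<open>v\<^sub>0\<close> from the ends of the
  segment. This puts the problem into a compact rectangle, on which \<open>F'\<close> is uniformly continuous.\<close>

lemma large_increment_away_from_ends:
  fixes F :: "complex \<Rightarrow> complex"
  assumes cont: "continuous_on half_strip F" and "0 < a"
    and big: "\<And>u. u < 0 \<Longrightarrow> \<exists>v v'. 0 < v \<and> v < pi \<and> 0 < v' \<and> v' < pi \<and> \<delta> < cmod (F (Complex u v) - F (Complex u v'))"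
  obtains v\<^sub>0 where "0 < v\<^sub>0" "v\<^sub>0 < pi / 2"
    "\<And>u. u \<in> {- N - a..- a} \<Longrightarrow> \<exists>v v'. v\<^sub>0 \<le> v \<and> v \<le> pi - v\<^sub>0 \<and> v\<^sub>0 \<le> v' \<and> v' \<le> pi - v\<^sub>0 \<and>
       \<delta> < cmod (F (Complex u v) - F (Complex u v'))"
proof -
  define P where "P = (\<lambda>v\<^sub>0 u. \<exists>v v'. v\<^sub>0 \<le> v \<and> v \<le> pi - v\<^sub>0 \<and> v\<^sub>0 \<le> v' \<and> v' \<le> pi - v\<^sub>0 \<and>
       \<delta> < cmod (F (Complex u v) - F (Complex u v')))"
  have "\<exists>k. \<forall>u\<in>{- N - a..- a}. P (inverse (real (Suc k))) u"
  proof (rule ccontr)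
    assume "\<not> ?thesis"
    then obtain u where u: "\<And>k. u k \<in> {- N - a..- a}" "\<And>k. \<not> P (inverse (real (Suc k))) (u k)"
      by metis
    obtain l r where lr: "l \<in> {- N - a..- a}" "strict_mono (r :: nat \<Rightarrow> nat)" "(u \<circ> r) \<longlonglongrightarrow> l"
      using compact_imp_seq_compact[OF compact_Icc[of "- N - a" "- a"]] u(1) by (metis seq_compactE)
    obtain v v' where v: "0 < v" "v < pi" "0 < v'" "v' < pi"
      and large: "\<delta> < cmod (F (Complex l v) - F (Complex l v'))"
      using big[of l] lr(1) \<open>0 < a\<close> by auto
    have tend: "(\<lambda>k. F (Complex (u (r k)) y)) \<longlonglongrightarrow> F (Complex l y)" if "0 < y" "y < pi" for y
    proof (rule continuous_on_tendsto_compose[OF cont])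
      show "(\<lambda>k. Complex (u (r k)) y) \<longlonglongrightarrow> Complex l y"
        using lr(3) by (intro tendsto_intros) (simp add: o_def)
      show "Complex l y \<in> half_strip" using lr(1) that \<open>0 < a\<close> by (simp add: half_strip_def)
      show "\<forall>\<^sub>F k in sequentially. Complex (u (r k)) y \<in> half_strip"
      proof (intro always_eventually allI)
        fix k show "Complex (u (r k)) y \<in> half_strip"
          using u(1)[of "r k"] that \<open>0 < a\<close> by (simp add: half_strip_def)
      qed
    qed
    define e where "e = min (min v (pi - v)) (min v' (pi - v'))"
    have "0 < e" using v by (simp add: e_def)
    have "(\<lambda>k. inverse (real (Suc (r k)))) \<longlonglongrightarrow> 0"
      using LIMSEQ_subseq_LIMSEQ[OF LIMSEQ_inverse_real_of_nat lr(2)] by (simp add: o_def)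
    then have "\<forall>\<^sub>F k in sequentially. inverse (real (Suc (r k))) < e"
      using \<open>0 < e\<close> by (rule order_tendstoD)
    then have small: "\<forall>\<^sub>F k in sequentially. cmod (F (Complex (u (r k)) v) - F (Complex (u (r k)) v')) \<le> \<delta>"
    proof eventually_elim
      case (elim k)
      then have "inverse (real (Suc (r k))) \<le> v" "v \<le> pi - inverse (real (Suc (r k)))"
         "inverse (real (Suc (r k))) \<le> v'" "v' \<le> pi - inverse (real (Suc (r k)))"
        unfolding e_def by linarith+
      then show ?case using u(2)[of "r k"] unfolding P_def by (meson not_le)
    qed
    have "cmod (F (Complex l v) - F (Complex l v')) \<le> \<delta>"
      by (rule tendsto_upperbound[OF _ small]) (intro tendsto_intros tend v, simp)
    with large show False by simp
  qed
  then obtain k where k: "\<And>u. u \<in> {- N - a..- a} \<Longrightarrow> P (inverse (real (Suc k))) u" by blast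
  show thesis
  proof (rule that[of "min (inverse (real (Suc k))) 1"])
    show "min (inverse (real (Suc k))) 1 < pi / 2" using pi_gt3 by linarith
    show "\<exists>v v'. min (inverse (real (Suc k))) 1 \<le> v \<and> v \<le> pi - min (inverse (real (Suc k))) 1 \<and>
          min (inverse (real (Suc k))) 1 \<le> v' \<and> v' \<le> pi - min (inverse (real (Suc k))) 1 \<and>
          \<delta> < cmod (F (Complex u v) - F (Complex u v'))" if u: "u \<in> {- N - a..- a}" for u
    proof -
      let ?e = "inverse (real (Suc k))"
      obtain v v' where "?e \<le> v" "v \<le> pi - ?e" "?e \<le> v'" "v' \<le> pi - ?e"
          "\<delta> < cmod (F (Complex u v) - F (Complex u v'))"
        using k[OF u] unfolding P_def by blast
      moreover have "min ?e 1 \<le> ?e" by simp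
      ultimately show ?thesis by (intro exI[of _ v] exI[of _ v']) linarith
    qed
  qed simp
qed

text \<open>The length-area argument. If every vertical crosscut had an image of diameter more than \<open>\<delta>\<close>, then
  \<open>\<integral> \<bar>F'\<bar>\<close> along it would be at least of order \<open>\<delta>\<close>, and by the Cauchy-Schwarz inequality \<open>\<integral> \<bar>F'\<bar>\<^sup>2\<close> of order \<open>\<delta>\<^sup>2\<close>,
  as the crosscut has length at most \<open>\<pi>\<close>. Summing over a rectangle of width \<open>N\<close> gives an area
  of order \<open>N \<delta>\<^sup>2\<close>, which exceeds the area of the disc containing the image for large \<open>N\<close>.\<close>

lemma strip_short_crosscut:
  assumes holF: "F holomorphic_on half_strip" and injF: "inj_on F half_strip"
    and FB: "F ` half_strip \<subseteq> ball c B" and "0 < \<delta>"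
  shows "\<exists>u<0. \<forall>v v'. 0 < v \<and> v < pi \<and> 0 < v' \<and> v' < pi \<longrightarrow>
      cmod (F (Complex u v) - F (Complex u v')) \<le> \<delta>"
proof (rule ccontr)
  assume "\<not> ?thesis"
  then have big: "\<exists>v v'. 0 < v \<and> v < pi \<and> 0 < v' \<and> v' < pi \<and> \<delta> < cmod (F (Complex u v) - F (Complex u v'))"
    if "u < 0" for u using that by (meson not_le)
  \<comment> \<open>\<open>9216 = 16 * 576\<close>: the Cauchy-Schwarz step starts from \<open>\<delta> / 4\<close> and the discs from Bloch's theorem
    have radius \<open>h * \<bar>F'\<bar> / 24\<close>.\<close>
  define N where "N = 2 * (9216 * pi * B\<^sup>2 / \<delta>\<^sup>2 + 1)"
  have "2 \<le> N" using \<open>0 < \<delta>\<close> by (simp add: N_def)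
  obtain v\<^sub>0 where v\<^sub>0: "0 < v\<^sub>0" "v\<^sub>0 < pi / 2" and
    osc: "\<And>u. u \<in> {- N - 1..- 1} \<Longrightarrow> \<exists>v v'. v\<^sub>0 \<le> v \<and> v \<le> pi - v\<^sub>0 \<and> v\<^sub>0 \<le> v' \<and> v' \<le> pi - v\<^sub>0 \<and>
       \<delta> < cmod (F (Complex u v) - F (Complex u v'))"
    using large_increment_away_from_ends[OF holomorphic_on_imp_continuous_on[OF holF] zero_less_one big, of N]
    by blast
  define K where "K = cbox (Complex (- N - 1) v\<^sub>0) (Complex (- 1) (pi - v\<^sub>0))"
  have KS: "K \<subseteq> half_strip"
    using v\<^sub>0 by (auto simp: K_def in_cbox_complex_iff half_strip_def)
  have "continuous_on K (deriv F)"
    using holomorphic_on_imp_continuous_on[OF holomorphic_deriv[OF holF open_half_strip]] KS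
    by (rule continuous_on_subset)
  then have "uniformly_continuous_on K (deriv F)"
    by (rule compact_uniformly_continuous) (simp add: K_def)
  moreover define \<eta> where "\<eta> = \<delta> / (4 * pi)"
  moreover have "0 < \<eta>" using \<open>0 < \<delta>\<close> by (simp add: \<eta>_def)
  ultimately obtain d where d: "0 < d"
    "\<And>z z'. z \<in> K \<Longrightarrow> z' \<in> K \<Longrightarrow> dist z' z < d \<Longrightarrow> dist (deriv F z') (deriv F z) < \<eta>"
    unfolding uniformly_continuous_on_def by metis
  define l where "l = pi - 2 * v\<^sub>0"
  have l: "0 < l" "l \<le> pi" using v\<^sub>0 by (auto simp: l_def)
  obtain m where m: "l / min d 1 < real m" using reals_Archimedean2 by blast
  define h where "h = l / real m"
  have "0 < l / min d 1" using l d by simp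
  then have "0 < real m" using m by linarith
  have "l < min d 1 * real m" using m \<open>0 < d\<close> by (simp add: pos_divide_less_eq mult.commute)
  then have "h < min d 1" unfolding h_def by (simp only: pos_divide_less_eq[OF \<open>0 < real m\<close>])
  then have h: "0 < h" "h < d" "h < 1" and mh: "real m * h = l"
    using \<open>0 < real m\<close> l by (auto simp: h_def)
  \<comment> \<open>With \<open>n\<close> columns of width \<open>h\<close> the grid covers more than half of the rectangle of width \<open>N\<close>.\<close>
  define n where "n = nat \<lfloor>N / h\<rfloor>"
  have "0 \<le> N / h" using \<open>2 \<le> N\<close> h by simp
  then have "real n \<le> N / h" "N / h < real n + 1" unfolding n_def by linarith+
  then have nh: "real n * h \<le> N" "N < real n * h + h" using h by (auto simp: field_simps)
  define D where "D = (\<lambda>i j. cmod (deriv F (grid_centre h v\<^sub>0 i j)))"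
  have row: "\<delta>\<^sup>2 / (9216 * pi) * h \<le> (\<Sum>j<m. (h * D i j / 24)\<^sup>2)" if "i < n" for i
  proof -
    define u where "u = - 1 - (real i + 1 / 2) * h"
    have "real i * h + h \<le> real n * h"
      using mult_right_mono[of "real i + 1" "real n" h] that h by (simp add: algebra_simps)
    moreover have "0 \<le> real i * h" using h by simp
    ultimately have u: "u \<in> {- N - 1..- 1}"
      using nh h by (auto simp: u_def algebra_simps)
    have inK: "Complex u y \<in> K" if "v\<^sub>0 \<le> y" "y \<le> pi - v\<^sub>0" for y
      using u that by (simp add: K_def in_cbox_complex_iff)
    have top: "v\<^sub>0 + real m * h = pi - v\<^sub>0" using mh by (simp add: l_def)
    have increment: "cmod (F (Complex u y) - F (Complex u v\<^sub>0)) \<le> (\<Sum>j<m. (D i j + \<eta>) * h)"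
      if y: "v\<^sub>0 \<le> y" "y \<le> pi - v\<^sub>0" for y
    proof (rule vertical_increment_bound[where F' = "deriv F"])
      show "(F has_field_derivative deriv F (Complex u y)) (at (Complex u y))"
        if "v\<^sub>0 \<le> y" "y \<le> v\<^sub>0 + real m * h" for y
        using inK[of y] that top KS by (intro holomorphic_derivI[OF holF open_half_strip]) auto
      show "cmod (deriv F (Complex u y)) \<le> D i j + \<eta>"
        if "j < m" "v\<^sub>0 + real j * h \<le> y" "y \<le> v\<^sub>0 + (real j + 1) * h" for j y
      proof -
        have jm: "real j * h + h \<le> real m * h"
          using mult_right_mono[of "real j + 1" "real m" h] that h by (simp add: algebra_simps)
        have j0: "0 \<le> real j * h" using h by simp
        have c: "grid_centre h v\<^sub>0 i j = Complex u (v\<^sub>0 + real j * h + h / 2)"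
          by (simp add: grid_centre_def u_def algebra_simps)
        have "dist (deriv F (Complex u y)) (deriv F (grid_centre h v\<^sub>0 i j)) < \<eta>"
        proof (rule d(2))
          show "grid_centre h v\<^sub>0 i j \<in> K" unfolding c using jm j0 h top by (intro inK) linarith+
          show "Complex u y \<in> K"
            using that(2,3)[unfolded distrib_right mult_1] jm j0 h top by (intro inK) linarith+
          have "dist (Complex u y) (grid_centre h v\<^sub>0 i j) = \<bar>y - (v\<^sub>0 + real j * h + h / 2)\<bar>"
            by (simp add: c dist_norm cmod_def)
          also have "\<dots> < d" using that h by (auto simp: algebra_simps abs_less_iff)
          finally show "dist (Complex u y) (grid_centre h v\<^sub>0 i j) < d" .
        qed
        then show ?thesis
          using norm_triangle_ineq2[of "deriv F (Complex u y)" "deriv F (grid_centre h v\<^sub>0 i j)"]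
          by (simp add: D_def dist_norm)
      qed
    qed (use h y top in auto)
    obtain v v' where v: "v\<^sub>0 \<le> v" "v \<le> pi - v\<^sub>0" "v\<^sub>0 \<le> v'" "v' \<le> pi - v\<^sub>0"
      and "\<delta> < cmod (F (Complex u v) - F (Complex u v'))"
      using osc[OF u] by blast
    then have "\<delta> < 2 * (\<Sum>j<m. (D i j + \<eta>) * h)"
      using increment[OF v(1,2)] increment[OF v(3,4)]
        norm_triangle_ineq4[of "F (Complex u v) - F (Complex u v\<^sub>0)" "F (Complex u v') - F (Complex u v\<^sub>0)"]
      by simp
    also have "(\<Sum>j<m. (D i j + \<eta>) * h) = h * (\<Sum>j<m. D i j) + l * \<eta>"
      by (simp add: sum.distrib sum_distrib_left algebra_simps flip: mh)
    also have "l * \<eta> \<le> pi * \<eta>" using l \<open>0 < \<eta>\<close> by (intro mult_right_mono) auto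
    also have "pi * \<eta> = \<delta> / 4" by (simp add: \<eta>_def)
    finally have "\<delta> / 4 \<le> h * (\<Sum>j<m. D i j)" by simp
    then have "(\<delta> / 4)\<^sup>2 \<le> (h * (\<Sum>j<m. D i j))\<^sup>2"
      using \<open>0 < \<delta>\<close> by (intro power_mono) auto
    also have "\<dots> \<le> h\<^sup>2 * ((\<Sum>j<m. (D i j)\<^sup>2) * real m)"
      using sum_squared_le_sum_of_squares[of "D i" "{..<m}"]
      by (simp add: power_mult_distrib mult_left_mono)
    also have "\<dots> = h * l * (\<Sum>j<m. (D i j)\<^sup>2)"
      by (simp add: power2_eq_square flip: mh)
    also have "\<dots> \<le> h * pi * (\<Sum>j<m. (D i j)\<^sup>2)"
      using l h by (intro mult_right_mono mult_left_mono sum_nonneg) auto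
    finally have "\<delta>\<^sup>2 / 16 \<le> h * pi * (\<Sum>j<m. (D i j)\<^sup>2)" by (simp add: power2_eq_square)
    then have "h / (576 * pi) * (\<delta>\<^sup>2 / 16) \<le> h / (576 * pi) * (h * pi * (\<Sum>j<m. (D i j)\<^sup>2))"
      using h by (intro mult_left_mono) auto
    also have "\<dots> = h\<^sup>2 / 576 * (\<Sum>j<m. (D i j)\<^sup>2)"
      by (simp add: power2_eq_square)
    also have "\<dots> = (\<Sum>j<m. (h * D i j / 24)\<^sup>2)"
      unfolding sum_distrib_left by (simp add: power_mult_distrib power_divide)
    finally show ?thesis by (simp add: mult_ac)
  qed
  have "\<delta>\<^sup>2 / (9216 * pi) * (real n * h) = (\<Sum>i<n. \<delta>\<^sup>2 / (9216 * pi) * h)" by simp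
  also have "\<dots> \<le> (\<Sum>i<n. \<Sum>j<m. (h * D i j / 24)\<^sup>2)"
    using row by (intro sum_mono) auto
  also have "\<dots> \<le> B\<^sup>2"
    unfolding D_def
    by (rule grid_derivative_sum_bound[OF holF injF FB]) (use h v\<^sub>0 mh in \<open>auto simp: l_def\<close>)
  finally have "real n * h \<le> 9216 * pi * B\<^sup>2 / \<delta>\<^sup>2"
    using \<open>0 < \<delta>\<close> by (simp add: field_simps)
  moreover have "9216 * pi * B\<^sup>2 / \<delta>\<^sup>2 + 1 = N / 2" by (simp add: N_def)
  ultimately show False using nh h \<open>2 \<le> N\<close> by linarith
qed

text \<open>The map \<open>\<zeta> \<mapsto> x + r exp \<zeta>\<close> carries the half strip onto the half disc and vertical crosscuts onto
  concentric semicircles.\<close>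

lemma short_crosscuts:
  fixes x :: real
  assumes hol: "f holomorphic_on upper_half_plane" and inj: "inj_on f upper_half_plane"
    and bdd: "\<And>S. bounded S \<Longrightarrow> S \<subseteq> upper_half_plane \<Longrightarrow> bounded (f ` S)" and "0 < r" "0 < \<delta>"
  obtains \<rho> where "0 < \<rho>" "\<rho> < r"
    "\<And>w w'. 0 < Im w \<Longrightarrow> 0 < Im w' \<Longrightarrow> cmod (w - of_real x) = \<rho> \<Longrightarrow> cmod (w' - of_real x) = \<rho> \<Longrightarrow>
      cmod (f w - f w') \<le> \<delta>"
proof -
  define \<phi> where "\<phi> = (\<lambda>\<zeta>. complex_of_real x + of_real r * exp \<zeta>)"
  have \<phi>: "0 < Im (\<phi> \<zeta>)" "cmod (\<phi> \<zeta> - of_real x) < r" if "\<zeta> \<in> half_strip" for \<zeta>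
    using that \<open>0 < r\<close> by (auto simp: \<phi>_def half_strip_def norm_mult Im_exp sin_gt_zero)
  have hol\<phi>: "\<phi> holomorphic_on half_strip"
    unfolding \<phi>_def by (intro holomorphic_intros)
  have inj\<phi>: "inj_on \<phi> half_strip"
  proof (rule inj_onI)
    fix \<zeta> \<zeta>' assume \<zeta>: "\<zeta> \<in> half_strip" "\<zeta>' \<in> half_strip" "\<phi> \<zeta> = \<phi> \<zeta>'"
    then have "exp \<zeta> = exp \<zeta>'" using \<open>0 < r\<close> by (simp add: \<phi>_def)
    moreover have "\<bar>Im \<zeta> - Im \<zeta>'\<bar> < 2 * pi"
      using \<zeta>(1,2) by (auto simp: half_strip_def)
    ultimately show "\<zeta> = \<zeta>'" by (rule exp_complex_eqI[rotated])
  qed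
  have "\<phi> ` half_strip \<subseteq> ball (of_real x) r"
    using \<phi>(2) by (auto simp: dist_norm norm_minus_commute)
  then have "bounded (f ` \<phi> ` half_strip)"
    using \<phi>(1) by (intro bdd) (auto intro: bounded_subset[OF bounded_ball])
  then obtain B where "(f \<circ> \<phi>) ` half_strip \<subseteq> ball 0 B"
    using bounded_subset_ballD[of _ 0] unfolding image_comp by metis
  moreover have "f \<circ> \<phi> holomorphic_on half_strip"
    using \<phi>(1) by (intro holomorphic_on_compose_gen[OF hol\<phi> hol]) auto
  moreover have "inj_on (f \<circ> \<phi>) half_strip"
    using \<phi>(1) by (intro comp_inj_on inj\<phi> inj_on_subset[OF inj]) auto
  ultimately obtain u where "u < 0" and
    u: "\<And>v v'. 0 < v \<Longrightarrow> v < pi \<Longrightarrow> 0 < v' \<Longrightarrow> v' < pi \<Longrightarrow>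
      cmod (f (\<phi> (Complex u v)) - f (\<phi> (Complex u v'))) \<le> \<delta>"
    using strip_short_crosscut[of "f \<circ> \<phi>" 0 B \<delta>] \<open>0 < \<delta>\<close> by auto
  \<comment> \<open>Every point of the semicircle of radius \<open>r exp u\<close> lies on the image of the vertical crosscut at \<open>u\<close>.\<close>
  have polar: "\<exists>v. 0 < v \<and> v < pi \<and> w = \<phi> (Complex u v)"
    if w: "0 < Im w" "cmod (w - of_real x) = r * exp u" for w
  proof (intro exI conjI)
    let ?z = "w - of_real x"
    have z: "0 < Im ?z" using w by simp
    then have "?z \<noteq> 0" by auto
    show "0 < Im (Ln ?z)" "Im (Ln ?z) < pi"
      using Im_Ln_pos_lt_imp[OF z] by auto
    have "Re (Ln ?z) = ln r + u"
      using w(2) \<open>?z \<noteq> 0\<close> \<open>0 < r\<close> by (simp add: ln_mult)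
    then have "Complex u (Im (Ln ?z)) = Ln ?z - of_real (ln r)"
      by (simp add: complex_eq_iff)
    then have "of_real r * exp (Complex u (Im (Ln ?z))) = ?z"
      using \<open>?z \<noteq> 0\<close> \<open>0 < r\<close> by (simp add: exp_diff exp_of_real)
    then show "w = \<phi> (Complex u (Im (Ln ?z)))" by (simp add: \<phi>_def)
  qed
  show thesis
  proof (rule that[of "r * exp u"])
    show "cmod (f w - f w') \<le> \<delta>"
      if w: "0 < Im w" "0 < Im w'" "cmod (w - of_real x) = r * exp u" "cmod (w' - of_real x) = r * exp u" for w w'
      using polar[OF w(1,3)] polar[OF w(2,4)] u by blast
  qed (use \<open>0 < r\<close> \<open>u < 0\<close> in auto)
qed

section \<open>Boundary limits of conformal maps\<close>

text \<open>A continuous map on a compact set is a quotient map onto its image.\<close>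

lemma locally_connected_continuous_image:
  fixes f :: "'a::real_normed_vector \<Rightarrow> 'b::real_normed_vector"
  assumes "compact S" "locally connected S" "continuous_on S f"
  shows "locally connected (f ` S)"
  using Abstract_Topology_2.continuous_imp_quotient_map[OF assms(3) refl assms(1)]
  by (intro locally_connected_quotient_image assms(2)) blast

text \<open>Connectedness im kleinen at \<open>q\<close> is enough. A set that does not contain \<open>q\<close> is avoided by a
  neighbourhood of \<open>q\<close>, so near \<open>q\<close> every point of the union lies in a set that contains \<open>q\<close>.\<close>

lemma locally_connected_Un:
  fixes S T :: "'a::real_normed_vector set"
  assumes "closed S" "closed T" and S: "locally connected S" and T: "locally connected T"
  shows "locally connected (S \<union> T)"
  unfolding locally_connected_im_kleinen
proof clarify
  fix V q assume V: "openin (top_of_set (S \<union> T)) V" and q: "q \<in> V"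
  obtain O' where O': "open O'" "V = (S \<union> T) \<inter> O'" using V by (auto simp: openin_open)
  have part: "\<exists>N. open N \<and> q \<in> N \<and> (\<forall>y\<in>X \<inter> N. \<exists>c. connected c \<and> c \<subseteq> X \<inter> O' \<and> q \<in> c \<and> y \<in> c)"
    if X: "closed X" "locally connected X" for X
  proof (cases "q \<in> X")
    case True
    have "openin (top_of_set X) (X \<inter> O')" using O' by (auto simp: openin_open)
    moreover have "q \<in> X \<inter> O'" using True q O' by auto
    ultimately obtain U where "openin (top_of_set X) U" "q \<in> U"
        "\<forall>y\<in>U. \<exists>c. connected c \<and> c \<subseteq> X \<inter> O' \<and> q \<in> c \<and> y \<in> c"
      using X(2) unfolding locally_connected_im_kleinen by metis
    then show ?thesis unfolding openin_open by auto
  next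
    case False
    then show ?thesis using X(1) by (intro exI[of _ "- X"]) auto
  qed
  obtain N where N: "open N" "q \<in> N"
    "\<And>y. y \<in> S \<inter> N \<Longrightarrow> \<exists>c. connected c \<and> c \<subseteq> S \<inter> O' \<and> q \<in> c \<and> y \<in> c"
    using part[OF \<open>closed S\<close> S] by metis
  obtain M where M: "open M" "q \<in> M"
    "\<And>y. y \<in> T \<inter> M \<Longrightarrow> \<exists>c. connected c \<and> c \<subseteq> T \<inter> O' \<and> q \<in> c \<and> y \<in> c"
    using part[OF \<open>closed T\<close> T] by metis
  have "\<exists>c. connected c \<and> c \<subseteq> V \<and> q \<in> c \<and> y \<in> c" if "y \<in> V \<inter> (N \<inter> M)" for y
    using that N(3)[of y] M(3)[of y] unfolding O'(2) by blast
  moreover have "openin (top_of_set (S \<union> T)) (V \<inter> (N \<inter> M))"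
    using O' N(1) M(1) by (auto simp: openin_open intro!: exI[of _ "O' \<inter> (N \<inter> M)"])
  ultimately show "\<exists>U. openin (top_of_set (S \<union> T)) U \<and> q \<in> U \<and> U \<subseteq> V \<and>
      (\<forall>y. y \<in> U \<longrightarrow> (\<exists>c. connected c \<and> c \<subseteq> V \<and> q \<in> c \<and> y \<in> c))"
    using q N(2) M(2) by (intro exI[of _ "V \<inter> (N \<inter> M)"]) blast
qed

text \<open>Passing to the closure of a connected neighbourhood makes it compact, as Janiszewski's theorem
  requires.\<close>

lemma locally_connected_small_continuum:
  fixes T :: "'a::euclidean_space set"
  assumes "closed T" "locally connected T" "q \<in> T" "0 < e"
  obtains d A where "0 < d" "connected A" "compact A" "A \<subseteq> T" "A \<subseteq> cball q e" "T \<inter> ball q d \<subseteq> A"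
proof -
  have "openin (top_of_set T) (T \<inter> ball q e)" "q \<in> T \<inter> ball q e"
    using assms by (auto simp: openin_open)
  then obtain U where U: "openin (top_of_set T) U" "connected U" "q \<in> U" "U \<subseteq> T \<inter> ball q e"
    using \<open>locally connected T\<close> unfolding locally_connected by metis
  then obtain O' where O': "open O'" "U = T \<inter> O'" by (auto simp: openin_open)
  then obtain d where "0 < d" "ball q d \<subseteq> O'" using U(3) by (auto simp: open_contains_ball)
  show thesis
  proof (rule that[of d "closure U"])
    show "connected (closure U)" using U(2) by (rule connected_imp_connected_closure)
    show ce: "closure U \<subseteq> cball q e" using U(4) by (intro closure_minimal) auto
    then show "compact (closure U)" using bounded_subset[OF bounded_cball] by (simp add: compact_eq_bounded_closed)
    show "closure U \<subseteq> T" using U(4) \<open>closed T\<close> by (intro closure_minimal) auto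
    show "T \<inter> ball q d \<subseteq> closure U" using O' \<open>ball q d \<subseteq> O'\<close> closure_subset by blast
  qed fact
qed

text \<open>The arc \<open>\<gamma>\<close> and the vertical half line both meet every small semicircle around \<open>x\<close>, and \<open>f\<close> is almost
  constant on suitable ones.\<close>

lemma limits_along_arcs_agree:
  fixes x :: real
  assumes hol: "f holomorphic_on upper_half_plane" and inj: "inj_on f upper_half_plane"
    and bdd: "\<And>S. bounded S \<Longrightarrow> S \<subseteq> upper_half_plane \<Longrightarrow> bounded (f ` S)"
    and cont: "continuous_on {0..<1} \<gamma>" and pos: "\<And>s. s \<in> {0..<1} \<Longrightarrow> 0 < Im (\<gamma> s)"
    and \<gamma>: "(\<gamma> \<longlongrightarrow> of_real x) (at_left (1::real))" and a: "((\<lambda>s. f (\<gamma> s)) \<longlongrightarrow> a) (at_left 1)"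
    and b: "((\<lambda>y. f (of_real x + \<i> * of_real y)) \<longlongrightarrow> b) (at_right 0)"
  shows "a = b"
proof (rule ccontr)
  assume "a \<noteq> b"
  define e where "e = dist a b / 4"
  have "0 < e" using \<open>a \<noteq> b\<close> by (simp add: e_def)
  have "\<forall>\<^sub>F s in at_left 1. dist (f (\<gamma> s)) a < e" using a \<open>0 < e\<close> by (rule tendstoD)
  then obtain s0 where s0: "s0 < 1" "\<And>s. s0 < s \<Longrightarrow> s < 1 \<Longrightarrow> dist (f (\<gamma> s)) a < e"
    by (auto simp: eventually_at_left[of 0])
  have "\<forall>\<^sub>F y in at_right 0. dist (f (of_real x + \<i> * of_real y)) b < e" using b \<open>0 < e\<close> by (rule tendstoD)
  then obtain y0 where y0: "0 < y0" "\<And>y. 0 < y \<Longrightarrow> y < y0 \<Longrightarrow> dist (f (of_real x + \<i> * of_real y)) b < e"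
    by (auto simp: eventually_at_right[of _ 1])
  \<comment> \<open>From \<open>s1\<close> on, \<open>f\<close> is close to \<open>a\<close> along the arc; a semicircle of radius less than the distance from \<open>\<gamma> s1\<close>
    to \<open>x\<close> is therefore met at a point where \<open>f\<close> is close to \<open>a\<close>.\<close>
  define s1 where "s1 = (max s0 0 + 1) / 2"
  have s1: "s0 < s1" "0 < s1" "s1 < 1" using s0 by (auto simp: s1_def max_def)
  have "\<gamma> s1 \<noteq> of_real x" using pos[of s1] s1 by auto
  then have "0 < min y0 (cmod (\<gamma> s1 - of_real x))" using y0 by simp
  then obtain \<rho> where \<rho>: "0 < \<rho>" "\<rho> < min y0 (cmod (\<gamma> s1 - of_real x))" and
    osc: "\<And>w w'. 0 < Im w \<Longrightarrow> 0 < Im w' \<Longrightarrow> cmod (w - of_real x) = \<rho> \<Longrightarrow> cmod (w' - of_real x) = \<rho> \<Longrightarrow>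
      cmod (f w - f w') \<le> e"
    using short_crosscuts[OF hol inj bdd _ \<open>0 < e\<close>, of _ x] by metis
  have "\<forall>\<^sub>F s in at_left 1. dist (\<gamma> s) (of_real x) < \<rho>" using \<gamma> \<open>0 < \<rho>\<close> by (rule tendstoD)
  then obtain s2 where s2: "s2 < 1" "\<And>s. s2 < s \<Longrightarrow> s < 1 \<Longrightarrow> dist (\<gamma> s) (of_real x) < \<rho>"
    by (auto simp: eventually_at_left[of 0])
  define s3 where "s3 = (max s1 s2 + 1) / 2"
  have s3: "s1 < s3" "s2 < s3" "s3 < 1" using s1 s2 by (auto simp: s3_def max_def)
  have "continuous_on {s1..s3} (\<lambda>s. cmod (\<gamma> s - of_real x))"
    using s1 s3 by (intro continuous_intros continuous_on_subset[OF cont]) auto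
  then obtain s where s: "s1 \<le> s" "s \<le> s3" "cmod (\<gamma> s - of_real x) = \<rho>"
    using IVT2'[of "\<lambda>s. cmod (\<gamma> s - of_real x)" s3 \<rho> s1] \<rho> s2(2)[OF s3(2,3)] s3(1)
    by (auto simp: dist_norm)
  have "dist (f (\<gamma> s)) (f (of_real x + \<i> * of_real \<rho>)) \<le> e"
    unfolding dist_norm using s s1 s3 \<rho> pos by (intro osc) (auto simp: norm_mult)
  moreover have "dist (f (\<gamma> s)) a < e" using s s1 s3 by (intro s0) auto
  moreover have "dist (f (of_real x + \<i> * of_real \<rho>)) b < e" using \<rho> by (intro y0) auto
  moreover have "dist a b \<le> dist (f (\<gamma> s)) a + dist (f (\<gamma> s)) (f (of_real x + \<i> * of_real \<rho>)) + dist (f (of_real x + \<i> * of_real \<rho>)) b"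
    by (metis add_right_mono dist_commute dist_triangle dist_triangle_le)
  moreover have "dist a b = 4 * e" by (simp add: e_def)
  ultimately show False using \<open>0 < e\<close> by linarith
qed

text \<open>The preimage of \<open>P\<close> under the conformal map is connected and meets both sides of the circle.\<close>

lemma connected_path_meets_crosscut:
  assumes hol: "f holomorphic_on upper_half_plane" and inj: "inj_on f upper_half_plane"
    and P: "connected P" "P \<subseteq> f ` upper_half_plane" and w: "0 < Im w" "f w \<in> P" "cmod (w - x) < \<rho>"
    and w': "0 < Im w'" "f w' \<in> P" "\<rho> < cmod (w' - x)"
  obtains z where "0 < Im z" "cmod (z - x) = \<rho>" "f z \<in> P"
proof -
  obtain h where h: "h holomorphic_on (f ` upper_half_plane)" "\<And>z. 0 < Im z \<Longrightarrow> h (f z) = z"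
    using holomorphic_has_inverse[OF hol open_halfspace_Im_gt inj] by (metis mem_Collect_eq)
  have "connected (h ` P)"
    using connected_continuous_image[OF continuous_on_subset[OF holomorphic_on_imp_continuous_on[OF h(1)] P(2)] P(1)] .
  moreover have "w \<in> h ` P" "w' \<in> h ` P"
    using h(2) w w' by (force intro: image_eqI)+
  ultimately have "h ` P \<inter> frontier (ball x \<rho>) \<noteq> {}"
    using w(3) w'(3) by (intro connected_Int_frontier) (auto simp: dist_norm norm_minus_commute)
  moreover have "frontier (ball x \<rho>) = sphere x \<rho>" using w(3) norm_ge_zero[of "w - x"] by (intro frontier_ball) linarith
  ultimately have "h ` P \<inter> sphere x \<rho> \<noteq> {}" by simp
  then obtain y where "y \<in> h ` P" "y \<in> sphere x \<rho>" by blast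
  then obtain p where p: "p \<in> P" "dist x (h p) = \<rho>" by auto
  then obtain z where "0 < Im z" "p = f z" using P(2) by auto
  with p h(2) show thesis by (intro that[of z]) (auto simp: dist_norm norm_minus_commute)
qed

text \<open>The candidate \<open>q\<close> for the limit is an accumulation point of the images of shrinking short
  semicircles; it lies in \<open>T\<close>. Given \<open>e\<close>, let \<open>C\<close> be the closed image of a short semicircle close to
  \<open>q\<close>, and let \<open>A\<close> be a small continuum in \<open>T\<close> containing all points of \<open>T\<close> near \<open>q\<close>. Then \<open>C \<union> A\<close> is
  compact, lies in the disc of radius \<open>e\<close> around \<open>q\<close>, and meets \<open>T\<close> exactly in the connected set \<open>A\<close>. If the
  enclosed half disc contained a point \<open>w\<close> with \<open>f w\<close> outside that disc, then neither \<open>C \<union> A\<close> nor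
  \<open>T\<close> would separate \<open>f w\<close> from a fixed value \<open>f b\<close> outside the disc, and by Janiszewski's theorem
  neither would their union. But a connected set avoiding \<open>T\<close> stays in the image of \<open>f\<close>, and its
  preimage has to cross the semicircle.\<close>

theorem limit_at_real_point:
  fixes x :: real
  assumes hol: "f holomorphic_on upper_half_plane" and inj: "inj_on f upper_half_plane"
    and bdd: "\<And>S. bounded S \<Longrightarrow> S \<subseteq> upper_half_plane \<Longrightarrow> bounded (f ` S)"
    and T: "closed T" "locally connected T" "f ` upper_half_plane \<inter> T = {}" "frontier (f ` upper_half_plane) \<subseteq> T"
  shows "\<exists>q. (f \<longlongrightarrow> q) (at (of_real x) within upper_half_plane)"
proof -
  define D where "D = f ` upper_half_plane"
  have "open D"
    unfolding D_def using open_mapping_thm3[OF hol open_halfspace_Im_gt inj] .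
  have "connected D"
    unfolding D_def by (intro connected_continuous_image holomorphic_on_imp_continuous_on hol convex_connected convex_halfspace_Im_gt)
  obtain h where h: "h holomorphic_on D" "\<And>z. 0 < Im z \<Longrightarrow> h (f z) = z"
    using holomorphic_has_inverse[OF hol open_halfspace_Im_gt inj] unfolding D_def by (metis mem_Collect_eq)
  have "\<exists>\<rho>. 0 < \<rho> \<and> \<rho> < inverse (real (Suc n)) \<and> (\<forall>w w'. 0 < Im w \<longrightarrow> 0 < Im w' \<longrightarrow>
      cmod (w - of_real x) = \<rho> \<longrightarrow> cmod (w' - of_real x) = \<rho> \<longrightarrow> cmod (f w - f w') \<le> inverse (real (Suc n)))" for n
    using short_crosscuts[OF hol inj bdd, of "inverse (real (Suc n))" "inverse (real (Suc n))" x]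
    by (metis inverse_positive_iff_positive of_nat_0_less_iff zero_less_Suc)
  then obtain \<rho> where \<rho>: "\<And>n. 0 < \<rho> n" "\<And>n. \<rho> n < inverse (real (Suc n))" and
    osc: "\<And>n w w'. 0 < Im w \<Longrightarrow> 0 < Im w' \<Longrightarrow> cmod (w - of_real x) = \<rho> n \<Longrightarrow> cmod (w' - of_real x) = \<rho> n \<Longrightarrow>
      cmod (f w - f w') \<le> inverse (real (Suc n))"
    by metis
  define c where "c = (\<lambda>n. of_real x + \<i> * of_real (\<rho> n))"
  have c: "0 < Im (c n)" "cmod (c n - of_real x) = \<rho> n" for n
    using \<rho>(1)[of n] by (auto simp: c_def norm_mult)
  have "\<rho> \<longlonglongrightarrow> 0"
    using LIMSEQ_inverse_real_of_nat \<rho> by (intro tendsto_sandwich[of "\<lambda>_. 0" \<rho> _ "\<lambda>n. inverse (real (Suc n))"])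
      (auto intro!: always_eventually less_imp_le)
  then have cx: "c \<longlonglongrightarrow> of_real x" unfolding c_def by (auto intro!: tendsto_eq_intros)
  have "bounded (f ` range c)"
    using c(1) by (intro bdd convergent_imp_bounded[OF cx]) auto
  then have "seq_compact (closure (f ` range c))"
    by (simp add: compact_imp_seq_compact)
  moreover have "\<forall>n. (f \<circ> c) n \<in> closure (f ` range c)"
    using closure_subset[of "f ` range c"] by auto
  ultimately obtain q r where r: "strict_mono (r :: nat \<Rightarrow> nat)" "((f \<circ> c) \<circ> r) \<longlonglongrightarrow> q"
    by (metis seq_compactE)
  have cr: "(c \<circ> r) \<longlonglongrightarrow> of_real x" using LIMSEQ_subseq_LIMSEQ[OF cx r(1)] .
  have "q \<notin> D"
  proof
    assume "q \<in> D"
    then have "(\<lambda>n. h (f (c (r n)))) \<longlonglongrightarrow> h q"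
      using r(2) holomorphic_on_imp_continuous_on[OF h(1)] \<open>open D\<close>
      by (intro isCont_tendsto_compose[of q h]) (auto simp: continuous_on_eq_continuous_at o_def)
    then have "h q = of_real x"
      using cr h(2)[OF c(1)] LIMSEQ_unique by (auto simp: o_def)
    moreover have "0 < Im (h q)" using \<open>q \<in> D\<close> h(2) by (auto simp: D_def)
    ultimately show False by simp
  qed
  moreover have "q \<in> closure D"
    unfolding closure_sequential using r(2) c(1) by (intro exI[of _ "(f \<circ> c) \<circ> r"]) (auto simp: D_def)
  ultimately have "q \<in> T"
    using T(4) interior_open[OF \<open>open D\<close>] by (auto simp: frontier_def D_def)
  \<comment> \<open>The reference point lies outside all the semicircles, whose radii are less than \<open>1\<close>.\<close>
  define b where "b = of_real x + \<i> * of_real 2"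
  have b: "0 < Im b" "cmod (b - of_real x) = 2" by (auto simp: b_def norm_mult)
  have "f b \<noteq> q" using \<open>q \<notin> D\<close> b by (auto simp: D_def)
  have near: "\<exists>s>0. \<forall>w. 0 < Im w \<and> cmod (w - of_real x) < s \<longrightarrow> dist q (f w) \<le> e"
    if "0 < e" "e < dist q (f b)" for e
  proof -
    obtain d A where A: "0 < d" "connected A" "compact A" "A \<subseteq> T" "A \<subseteq> cball q e" "T \<inter> ball q d \<subseteq> A"
      using locally_connected_small_continuum[OF T(1,2) \<open>q \<in> T\<close> \<open>0 < e\<close>] .
    define d' where "d' = min d e"
    have "0 < d'" using A \<open>0 < e\<close> by (simp add: d'_def)
    have "(\<lambda>n. inverse (real (Suc (r n)))) \<longlonglongrightarrow> 0"
      using LIMSEQ_subseq_LIMSEQ[OF LIMSEQ_inverse_real_of_nat r(1)] by (simp add: o_def)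
    then have "\<forall>\<^sub>F n in sequentially. inverse (real (Suc (r n))) < d' / 4"
      using \<open>0 < d'\<close> by (intro order_tendstoD) auto
    moreover have "\<forall>\<^sub>F n in sequentially. dist (f (c (r n))) q < d' / 4"
      using tendstoD[OF r(2), of "d' / 4"] \<open>0 < d'\<close> by (simp add: o_def)
    ultimately have "\<forall>\<^sub>F n in sequentially. inverse (real (Suc (r n))) < d' / 4 \<and> dist (f (c (r n))) q < d' / 4"
      by eventually_elim simp
    then obtain n' where n': "inverse (real (Suc (r n'))) < d' / 4" "dist (f (c (r n'))) q < d' / 4"
      using eventually_happens'[OF sequentially_bot] by blast
    define n where "n = r n'"
    have n: "inverse (real (Suc n)) < d' / 4" "dist (f (c n)) q < d' / 4"
      using n' by (simp_all add: n_def)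
    have "\<rho> n < 2"
      using \<rho>(2)[of n] inverse_le_1_iff[of "real (Suc n)"] by simp
    define C where "C = closure (f ` {w. 0 < Im w \<and> cmod (w - of_real x) = \<rho> n})"
    have "f ` {w. 0 < Im w \<and> cmod (w - of_real x) = \<rho> n} \<subseteq> cball q (d' / 2)"
    proof clarify
      fix w assume w: "0 < Im w" "cmod (w - of_real x) = \<rho> n"
      have "dist (f w) (f (c n)) \<le> d' / 4"
        using osc[OF w(1) c(1) w(2) c(2)] n(1) by (simp add: dist_norm)
      then show "f w \<in> cball q (d' / 2)"
        using n(2) dist_triangle[of q "f w" "f (c n)"] by (simp add: dist_commute)
    qed
    then have C: "C \<subseteq> cball q (d' / 2)" unfolding C_def by (intro closure_minimal) auto
    have "compact C"
      unfolding C_def using C bounded_subset[OF bounded_cball] by (simp add: C_def compact_eq_bounded_closed)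
    have "C \<subseteq> ball q d'" using C \<open>0 < d'\<close> by (auto simp: subset_iff)
    then have CA: "(C \<union> A) \<inter> T = A" using A(4,6) by (auto simp: d'_def subset_iff)
    have Ce: "C \<union> A \<subseteq> cball q e" using \<open>C \<subseteq> ball q d'\<close> A(5) by (auto simp: d'_def subset_iff)
    have "dist q (f w) \<le> e" if w: "0 < Im w" "cmod (w - of_real x) < \<rho> n" for w
    proof (rule ccontr)
      assume out: "\<not> dist q (f w) \<le> e"
      have "connected_component (- ((C \<union> A) \<union> T)) (f w) (f b)"
      proof (rule Janiszewski)
        show "compact (C \<union> A)" using \<open>compact C\<close> A(3) by (rule compact_Un)
        show "closed T" by fact
        show "connected ((C \<union> A) \<inter> T)" using CA A(2) by simp
        have "connected (- cball q e)" by (intro connected_complement_bounded_convex) auto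
        then show "connected_component (- (C \<union> A)) (f w) (f b)"
          using Ce out \<open>e < dist q (f b)\<close> unfolding connected_component_def
          by (intro exI[of _ "- cball q e"]) auto
        show "connected_component (- T) (f w) (f b)"
          using \<open>connected D\<close> T(3) w b unfolding connected_component_def
          by (intro exI[of _ D]) (auto simp: D_def)
      qed
      then obtain P where P: "connected P" "P \<subseteq> - (C \<union> A \<union> T)" "f w \<in> P" "f b \<in> P"
        unfolding connected_component_def by blast
      have "P \<inter> frontier D = {}" using P(2) T(4) unfolding D_def by blast
      moreover have "P \<inter> D \<noteq> {}" using P(3) w(1) by (auto simp: D_def)
      ultimately have "P \<subseteq> D" using connected_Int_frontier[OF P(1)] by blast
      then obtain z where z: "0 < Im z" "cmod (z - of_real x) = \<rho> n" "f z \<in> P"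
        using connected_path_meets_crosscut[OF hol inj P(1) _ w(1) P(3) w(2) b(1) P(4)] \<open>\<rho> n < 2\<close> b(2)
        unfolding D_def by metis
      then have "f z \<in> C" unfolding C_def using closure_subset by fast
      with z(3) P(2) show False by blast
    qed
    then show ?thesis using \<rho>(1) by blast
  qed
  have "(f \<longlongrightarrow> q) (at (of_real x) within upper_half_plane)"
  proof (rule tendstoI)
    fix e :: real assume "0 < e"
    define e' where "e' = min (e / 2) (dist q (f b) / 2)"
    have e': "0 < e'" "e' < dist q (f b)" "e' < e"
      using \<open>0 < e\<close> \<open>f b \<noteq> q\<close> by (auto simp: e'_def min_def)
    then obtain s where "0 < s" "\<And>w. 0 < Im w \<Longrightarrow> cmod (w - of_real x) < s \<Longrightarrow> dist q (f w) \<le> e'"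
      using near by blast
    then show "\<forall>\<^sub>F w in at (of_real x) within upper_half_plane. dist (f w) q < e"
      unfolding eventually_at using \<open>e' < e\<close>
      by (intro exI[of _ s]) (fastforce simp: dist_norm norm_minus_commute)
  qed
  then show ?thesis by blast
qed

lemma continuous_extension_by_limits:
  fixes f :: "'a::metric_space \<Rightarrow> 'b::metric_space"
  assumes cont: "continuous_on S f"
    and lim: "\<And>x. x \<in> closure S - S \<Longrightarrow> \<exists>q. (f \<longlongrightarrow> q) (at x within S)"
  shows "\<exists>G. continuous_on (closure S) G \<and> (\<forall>x\<in>S. G x = f x)"
proof -
  obtain q where q: "\<And>x. x \<in> closure S - S \<Longrightarrow> (f \<longlongrightarrow> q x) (at x within S)"
    using lim by metis
  define G where "G = (\<lambda>x. if x \<in> S then f x else q x)"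
  have "\<exists>d>0. \<forall>y\<in>S. dist y x < d \<longrightarrow> dist (G y) (G x) < e" if x: "x \<in> closure S" and "0 < e" for x e
  proof (cases "x \<in> S")
    case True
    then show ?thesis using cont \<open>0 < e\<close> by (auto simp: G_def continuous_on_iff)
  next
    case False
    then obtain d where "0 < d" "\<forall>y\<in>S. y \<noteq> x \<and> dist y x < d \<longrightarrow> dist (f y) (q x) < e"
      using tendstoD[OF q \<open>0 < e\<close>, of x] x by (auto simp: eventually_at)
    with False show ?thesis by (auto simp: G_def)
  qed
  then have "continuous_on (closure S) G" unfolding continuous_on_closure by blast
  then show ?thesis by (intro exI[of _ G]) (auto simp: G_def)
qed

section \<open>The curve of radial limits\<close>

text \<open>Closed sublevel sets make \<open>\<theta>\<close> lower semicontinuous; the minimum is attained on a closed set, and \<open>m\<close> is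
  the least point of that set.\<close>

lemma first_minimum:
  fixes \<theta> :: "real \<Rightarrow> 'a::linorder"
  assumes closed: "\<And>p. p \<in> {0..1} \<Longrightarrow> closed {s \<in> {0..1}. \<theta> s \<le> \<theta> p}"
  obtains m where "m \<in> {0..1}" "\<And>s. s \<in> {0..1} \<Longrightarrow> \<theta> m \<le> \<theta> s" "\<And>s. 0 \<le> s \<Longrightarrow> s < m \<Longrightarrow> \<theta> m < \<theta> s"
proof -
  define X where "X = (\<lambda>p. {s \<in> {0..1}. \<theta> s \<le> \<theta> p})"
  have "{0..1} \<inter> \<Inter> (X ` {0..1}) \<noteq> {}"
  proof (rule compact_imp_fip[OF compact_Icc])
    show "closed S" if "S \<in> X ` {0..1}" for S using that closed by (auto simp: X_def)
    show "{0..1} \<inter> \<Inter> F \<noteq> {}" if F: "finite F" "F \<subseteq> X ` {0..1}" for F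
    proof -
      obtain C where C: "C \<subseteq> {0..1}" "finite C" "F = X ` C"
        using finite_subset_image[OF F] by metis
      show ?thesis
      proof (cases "C = {}")
        case False
        then have "Min (\<theta> ` C) \<in> \<theta> ` C" using C(2) by (intro Min_in) auto
        then obtain c where "c \<in> C" "\<theta> c = Min (\<theta> ` C)" by auto
        then have "c \<in> {0..1} \<inter> \<Inter> F" using C by (auto simp: X_def)
        then show ?thesis by blast
      qed (use C in auto)
    qed
  qed
  then obtain p where "p \<in> {0..1}" "p \<in> \<Inter> (X ` {0..1})" by blast
  then have p: "p \<in> {0..1}" "\<And>s. s \<in> {0..1} \<Longrightarrow> \<theta> p \<le> \<theta> s" by (auto simp: X_def)
  have "compact (X p)"
    using closed[OF p(1)] by (auto simp: X_def compact_eq_bounded_closed intro: bounded_subset[of "{0..1}"])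
  moreover have "p \<in> X p" using p by (simp add: X_def)
  ultimately obtain m where m: "m \<in> X p" "\<And>s. s \<in> X p \<Longrightarrow> m \<le> s"
    using compact_attains_inf[of "X p"] by blast
  show thesis
  proof (rule that[of m])
    show min: "\<theta> m \<le> \<theta> s" if "s \<in> {0..1}" for s using m(1) p(2)[OF that] by (auto simp: X_def)
    show "\<theta> m < \<theta> s" if "0 \<le> s" "s < m" for s
      using m(1) m(2)[of s] min[of p] p(1) that by (force simp: X_def)
  qed (use m in \<open>auto simp: X_def\<close>)
qed

locale loewner_radial_limits = loewner_chain +
  fixes \<beta> :: "real \<Rightarrow> complex"
  assumes radial_limit: "\<And>t. 0 \<le> t \<Longrightarrow>
      ((\<lambda>y. loewner_inverse g \<tau> t (of_real (\<xi> t) + \<i> * of_real y)) \<longlongrightarrow> \<beta> t) (at_right 0)"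
    and \<beta>_continuous: "continuous_on {0..} \<beta>"
begin

text \<open>Along the image under \<open>g \<sigma>\<close> of the half-open segment, \<open>f \<sigma>\<close> tends to \<open>z\<close>; along the vertical line
  it tends to \<open>\<beta> \<sigma>\<close>. Both arcs end at \<open>\<xi> \<sigma>\<close>.\<close>

lemma \<beta>_eq_accessible_point:
  assumes z: "0 < Im z" "\<tau> z = ereal \<sigma>" "0 < \<sigma>"
    and seg: "\<And>s. s \<in> {0..<1} \<Longrightarrow> p + of_real s * (z - p) \<in> H \<sigma>"
  shows "\<beta> \<sigma> = z"
proof -
  define l where "l = (\<lambda>s::real. p + of_real s * (z - p))"
  have l: "l s \<in> H \<sigma>" if "s \<in> {0..<1}" for s using seg[OF that] by (simp add: l_def)
  have "\<sigma> \<ge> 0" using z by simp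
  have "z \<notin> H \<sigma>" using z by (simp add: mem_domain)
  have ev: "\<forall>\<^sub>F s in at_left (1::real). s \<in> {0..<1}"
    using eventually_at_left_real[OF zero_less_one] by eventually_elim auto
  have lz: "(l \<longlongrightarrow> z) (at_left 1)"
    unfolding l_def by (auto intro!: tendsto_eq_intros)
  moreover have "\<forall>\<^sub>F s in at_left 1. l s \<in> H \<sigma> \<and> l s \<noteq> z"
    using ev by eventually_elim (use l \<open>z \<notin> H \<sigma>\<close> in auto)
  ultimately have lz': "filterlim l (at z within H \<sigma>) (at_left 1)"
    by (simp add: filterlim_at)
  have "z = \<beta> \<sigma>"
  proof (rule limits_along_arcs_agree)
    show "f \<sigma> holomorphic_on upper_half_plane" "inj_on (f \<sigma>) upper_half_plane"
      using inverse_holomorphic inverse_injective \<open>\<sigma> \<ge> 0\<close> by auto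
    show "bounded (f \<sigma> ` S)" if "bounded S" "S \<subseteq> upper_half_plane" for S
      using inverse_bounded that \<open>\<sigma> \<ge> 0\<close> by blast
    show "continuous_on {0..<1} (\<lambda>s. g \<sigma> (l s))"
      by (rule continuous_on_compose2[OF flow_continuous_on_domain[OF \<open>\<sigma> \<ge> 0\<close>]])
         (use l in \<open>auto simp: l_def intro!: continuous_intros\<close>)
    show "0 < Im (g \<sigma> (l s))" if "s \<in> {0..<1}" for s
      using Im_flow_pos[OF l[OF that] \<open>\<sigma> \<ge> 0\<close>] .
    show "((\<lambda>s. g \<sigma> (l s)) \<longlongrightarrow> of_real (\<xi> \<sigma>)) (at_left 1)"
      using filterlim_compose[OF flow_tends_to_driving[OF z] lz'] .
    have "\<forall>\<^sub>F s in at_left 1. l s = f \<sigma> (g \<sigma> (l s))"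
      using ev by eventually_elim (use inverse_flow l \<open>\<sigma> \<ge> 0\<close> in auto)
    with lz show "((\<lambda>s. f \<sigma> (g \<sigma> (l s))) \<longlongrightarrow> z) (at_left 1)"
      by (rule Lim_transform_eventually)
    show "((\<lambda>y. f \<sigma> (of_real (\<xi> \<sigma>) + \<i> * of_real y)) \<longlongrightarrow> \<beta> \<sigma>) (at_right 0)"
      by (rule radial_limit) fact
  qed
  then show ?thesis by simp
qed

lemma \<beta>_continuous_on_interval: "continuous_on {0..t} \<beta>"
  by (rule continuous_on_subset[OF \<beta>_continuous]) auto

lemma compact_\<beta>_image: "compact (\<beta> ` {0..t})"
  using \<beta>_continuous_on_interval by (intro compact_continuous_image) auto

text \<open>On the segment from a point \<open>p\<close> of \<open>H t\<close> to \<open>z\<close>, the first point of minimal lifetime \<open>\<sigma> \<le> t\<close> is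
  reached through points of longer life, that is, through \<open>H \<sigma>\<close>. Hence it equals \<open>\<beta> \<sigma>\<close>, and it is at least as close
  to \<open>z\<close> as \<open>p\<close> is.\<close>

lemma frontier_domain_subset_curve:
  assumes "0 \<le> t" and z: "z \<in> frontier (H t)" "0 < Im z"
  shows "z \<in> \<beta> ` {0..t}"
proof -
  have "z \<notin> H t" "z \<in> closure (H t)"
    using z(1) domain_open[OF \<open>0 \<le> t\<close>] by (auto simp: frontier_def interior_open)
  have "\<exists>y\<in>\<beta> ` {0..t}. dist y z < e" if "0 < e" for e
  proof -
    obtain p where p: "p \<in> H t" "dist p z < e"
      using \<open>z \<in> closure (H t)\<close> \<open>0 < e\<close> by (auto simp: closure_approachable)
    define l where "l = (\<lambda>s::real. p + of_real s * (z - p))"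
    have l: "0 < Im (l s)" if "s \<in> {0..1}" for s
    proof -
      have "0 < (1 - s) * Im p + s * Im z"
        using p(1) z(2) that
        by (cases "s = 0") (auto simp: mem_domain intro!: add_nonneg_pos)
      then show ?thesis by (simp add: l_def algebra_simps)
    qed
    have contl: "continuous_on {0..1} l" unfolding l_def by (intro continuous_intros)
    have "closed {s \<in> {0..1}. \<tau> (l s) \<le> \<tau> (l q)}" if q: "q \<in> {0..1}" for q
    proof (cases "\<tau> (l q)")
      case (real i)
      then have "0 \<le> i" using lifetime_pos[OF l[OF q]] by simp
      have eq: "{s \<in> {0..1}. \<tau> (l s) \<le> \<tau> (l q)} = {0..1} \<inter> l -` (- H i)"
        using l real by (auto simp: mem_domain not_less)
      show ?thesis
        unfolding eq using domain_open[OF \<open>0 \<le> i\<close>]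
        by (intro continuous_closed_preimage[OF contl]) auto
    next
      case PInf
      then have "{s \<in> {0..1}. \<tau> (l s) \<le> \<tau> (l q)} = {0..1}" by auto
      then show ?thesis by simp
    next
      case MInf
      then show ?thesis using lifetime_pos[OF l[OF q]] by simp
    qed
    from first_minimum[of "\<lambda>s. \<tau> (l s)", OF this] obtain m where m: "m \<in> {0..1}" "\<And>s. s \<in> {0..1} \<Longrightarrow> \<tau> (l m) \<le> \<tau> (l s)"
      "\<And>s. 0 \<le> s \<Longrightarrow> s < m \<Longrightarrow> \<tau> (l m) < \<tau> (l s)"
      by blast
    have "\<tau> (l m) \<le> \<tau> (l 1)" by (rule m(2)) simp
    then have "\<tau> (l m) \<le> ereal t" using \<open>z \<notin> H t\<close> z(2) by (simp add: l_def mem_domain)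
    then obtain \<sigma> where \<sigma>: "\<tau> (l m) = ereal \<sigma>" "0 < \<sigma>" "\<sigma> \<le> t"
      using lifetime_pos[OF l[OF m(1)]] by (cases "\<tau> (l m)") auto
    have "m \<noteq> 0" using p(1) \<sigma> by (auto simp: l_def mem_domain)
    have "\<beta> \<sigma> = l m"
    proof (rule \<beta>_eq_accessible_point[OF l[OF m(1)] \<sigma>(1,2)])
      fix s :: real assume s: "s \<in> {0..<1}"
      then have "s * m < m" "0 \<le> s * m" using m(1) \<open>m \<noteq> 0\<close> by auto
      then have "l (s * m) \<in> H \<sigma>"
        using l[of "s * m"] m(1) m(3)[of "s * m"] \<sigma>(1) by (auto simp: mem_domain)
      then show "p + of_real s * (l m - p) \<in> H \<sigma>" by (simp add: l_def mult.assoc)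
    qed
    moreover have "dist (l m) z \<le> dist p z"
    proof -
      have "l m - z = of_real (1 - m) * (p - z)" by (simp add: l_def algebra_simps)
      then have "dist (l m) z = (1 - m) * dist p z"
        using m(1) by (simp add: dist_norm norm_mult del: of_real_diff)
      also have "\<dots> \<le> dist p z" using m(1) by (intro mult_left_le_one_le) auto
      finally show ?thesis .
    qed
    ultimately have "dist (\<beta> \<sigma>) z < e" using p(2) by simp
    moreover have "\<beta> \<sigma> \<in> \<beta> ` {0..t}" using \<sigma> by (intro imageI) auto
    ultimately show ?thesis by blast
  qed
  then show ?thesis
    using closed_approachable[OF compact_imp_closed[OF compact_\<beta>_image]] by blast
qed

text \<open>If \<open>\<beta> s\<close> were in \<open>H s\<close>, continuity of \<open>g s\<close> there would make it send \<open>\<beta> s\<close> to the limit \<open>\<xi> s\<close> of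
  \<open>\<xi> s + \<i> y\<close>, which is not in the open half plane.\<close>

lemma curve_disjoint_domain:
  assumes "0 \<le> s" "s \<le> t"
  shows "\<beta> s \<notin> H t"
proof
  assume "\<beta> s \<in> H t"
  then have \<beta>H: "\<beta> s \<in> H s" using domain_antimono assms by blast
  have "((\<lambda>y. g s (f s (of_real (\<xi> s) + \<i> * of_real y))) \<longlongrightarrow> g s (\<beta> s)) (at_right 0)"
    using isCont_tendsto_compose[OF flow_isCont[OF assms(1) \<beta>H] radial_limit[OF assms(1)]] .
  moreover have "\<forall>\<^sub>F y in at_right 0. g s (f s (of_real (\<xi> s) + \<i> * of_real y)) = of_real (\<xi> s) + \<i> * of_real y"
    using eventually_at_right_real[OF zero_less_one] by eventually_elim (use flow_inverse assms in auto)
  ultimately have "((\<lambda>y. of_real (\<xi> s) + \<i> * of_real y) \<longlongrightarrow> g s (\<beta> s)) (at_right 0)"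
    by (rule Lim_transform_eventually)
  moreover have "((\<lambda>y. of_real (\<xi> s) + \<i> * of_real y) \<longlongrightarrow> complex_of_real (\<xi> s)) (at_right 0)"
    by (auto intro!: tendsto_eq_intros)
  ultimately have "g s (\<beta> s) = of_real (\<xi> s)"
    using tendsto_unique trivial_limit_at_right_real by blast
  then show False using Im_flow_pos[OF \<beta>H assms(1)] by simp
qed

text \<open>The limit theorem is applied with the union of the real line and the curve; a union of
  two closed locally connected sets is locally connected.\<close>

lemma inverse_extends_continuously:
  assumes "0 \<le> t"
  shows "\<exists>G. continuous_on (closure upper_half_plane) G \<and> (\<forall>w\<in>upper_half_plane. G w = f t w)"
proof (rule continuous_extension_by_limits)
  show "continuous_on upper_half_plane (f t)"
    using inverse_holomorphic[OF assms] by (rule holomorphic_on_imp_continuous_on)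
  fix x assume x: "x \<in> closure upper_half_plane - upper_half_plane"
  have "closure upper_half_plane \<subseteq> {z. 0 \<le> Im z}"
    by (intro closure_minimal closed_halfspace_Im_ge) auto
  with x have "x = of_real (Re x)" by (auto simp: complex_eq_iff)
  moreover have "\<exists>q. (f t \<longlongrightarrow> q) (at (of_real (Re x)) within upper_half_plane)"
  proof (rule limit_at_real_point)
    show "f t holomorphic_on upper_half_plane" "inj_on (f t) upper_half_plane"
      using inverse_holomorphic inverse_injective assms by auto
    show "bounded (f t ` S)" if "bounded S" "S \<subseteq> upper_half_plane" for S
      using inverse_bounded that assms by blast
    show "closed ({z. Im z = 0} \<union> \<beta> ` {0..t})"
      using compact_imp_closed[OF compact_\<beta>_image] by (intro closed_Un closed_halfspace_Im_eq) 
    show "locally connected ({z. Im z = 0} \<union> \<beta> ` {0..t})"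
      using compact_imp_closed[OF compact_\<beta>_image] 
      by (intro locally_connected_Un closed_halfspace_Im_eq locally_connected_continuous_image
          convex_imp_locally_connected convex_real_interval \<beta>_continuous_on_interval) (auto simp: convex_alt)
    show "f t ` upper_half_plane \<inter> ({z. Im z = 0} \<union> \<beta> ` {0..t}) = {}"
      unfolding inverse_image[OF assms] using curve_disjoint_domain by (auto simp: mem_domain)
    have "closure (H t) \<subseteq> {z. 0 \<le> Im z}"
      by (intro closure_minimal closed_halfspace_Im_ge) (auto simp: mem_domain)
    then show "frontier (f t ` upper_half_plane) \<subseteq> {z. Im z = 0} \<union> \<beta> ` {0..t}"
      unfolding inverse_image[OF assms]
      using frontier_domain_subset_curve[OF assms] by (force simp: frontier_def)
  qed
  ultimately show "\<exists>q. (f t \<longlongrightarrow> q) (at x within upper_half_plane)" by metis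
qed

text \<open>A component of the complement of the curve that meets \<open>H t\<close> cannot leave it, because it would have to
  cross the frontier of \<open>H t\<close> inside the half plane, which lies on the curve. Unbounded components do
  meet \<open>H t\<close>, because it contains all points of the half plane far from \<open>\<xi> 0\<close>.\<close>

lemma domain_is_unbounded_component:
  assumes "0 \<le> t"
  shows "{C \<in> components (upper_half_plane - \<beta> ` {0..t}). \<not> bounded C} = {H t}"
proof -
  let ?U = "upper_half_plane - \<beta> ` {0..t}"
  obtain R where R: "0 < R" "\<And>z. 0 < Im z \<Longrightarrow> R \<le> cmod (z - of_real (\<xi> 0)) \<Longrightarrow> z \<in> H t"
    using flow_moves_little_far_away[OF assms] by metis
  have meets: "C \<inter> H t \<noteq> {}" if "\<not> bounded C" "C \<subseteq> upper_half_plane" for C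
  proof
    assume "C \<inter> H t = {}"
    then have "C \<subseteq> ball (of_real (\<xi> 0)) R"
      using R(2) that(2) by (force simp: dist_norm norm_minus_commute not_le)
    with that(1) show False using bounded_subset[OF bounded_ball] by blast
  qed
  have sub: "H t \<subseteq> ?U" using curve_disjoint_domain by (auto simp: mem_domain)
  have unbounded: "\<not> bounded (H t)"
  proof
    assume "bounded (H t)"
    then obtain M where M: "\<And>z. z \<in> H t \<Longrightarrow> cmod z \<le> M" by (auto simp: bounded_iff)
    define z where "z = of_real (\<xi> 0) + \<i> * of_real (R + \<bar>M\<bar> + 1)"
    have "z \<in> H t" using R(1) by (intro R(2)) (auto simp: z_def norm_mult simp del: of_real_add)
    then have "cmod z \<le> M" by (rule M)
    moreover have "R + \<bar>M\<bar> + 1 \<le> cmod z" using abs_Im_le_cmod[of z] R(1) by (simp add: z_def)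
    ultimately show False using R(1) by linarith
  qed
  have component: "C = H t" if C: "C \<in> components ?U" "C \<inter> H t \<noteq> {}" for C
  proof
    have "connected C" "C \<subseteq> ?U" using in_components_connected[OF C(1)] in_components_subset[OF C(1)] by blast+
    show "C \<subseteq> H t"
    proof (rule ccontr)
      assume "\<not> C \<subseteq> H t"
      then obtain z where "z \<in> C" "z \<in> frontier (H t)"
        using connected_Int_frontier[OF \<open>connected C\<close> C(2)] by blast
      then show False using frontier_domain_subset_curve[OF assms] \<open>C \<subseteq> ?U\<close> by auto
    qed
    show "H t \<subseteq> C"
      using components_maximal[OF C(1) domain_connected[OF assms] sub] C(2) by blast
  qed
  have "H t \<noteq> {}" using unbounded by auto
  then obtain z where z: "z \<in> H t" by blast
  define C\<^sub>0 where "C\<^sub>0 = connected_component_set ?U z"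
  have C0: "C\<^sub>0 \<in> components ?U" using z sub by (auto simp: C\<^sub>0_def intro!: componentsI)
  moreover have "z \<in> C\<^sub>0" using z sub by (auto simp: C\<^sub>0_def)
  ultimately have "C\<^sub>0 = H t" using component z by blast
  with C0 have "H t \<in> components ?U" by simp
  show ?thesis
  proof (intro equalityI subsetI)
    fix C assume "C \<in> {C \<in> components ?U. \<not> bounded C}"
    then have C: "C \<in> components ?U" "\<not> bounded C" by auto
    then have "C \<subseteq> upper_half_plane" using in_components_subset by blast
    then show "C \<in> {H t}" using component[OF C(1) meets[OF C(2)]] by simp
  qed (use \<open>H t \<in> components ?U\<close> unbounded in auto)
qed

end

theorem theorem4p1:
  fixes \<xi> :: "real \<Rightarrow> real"
    and g :: "real \<Rightarrow> complex \<Rightarrow> complex"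
    and \<tau> :: "complex \<Rightarrow> ereal"
    and \<beta> :: "real \<Rightarrow> complex"
  assumes "continuous_on {0..} \<xi>"
    and "loewner_flow \<xi> g \<tau>"
    and "\<forall>t\<ge>0. ((\<lambda>y::real. loewner_inverse g \<tau> t (complex_of_real (\<xi> t) + \<i> * complex_of_real y))
                  \<longlongrightarrow> \<beta> t) (at_right 0)"
    and "continuous_on {0..} \<beta>"
  shows "\<forall>t\<ge>0.
      (\<exists>G. continuous_on (closure upper_half_plane) G \<and>
           (\<forall>w\<in>upper_half_plane. G w = loewner_inverse g \<tau> t w)) \<and>
      {C \<in> components (upper_half_plane - \<beta> ` {0..t}). \<not> bounded C} = {loewner_domain \<tau> t}"
proof -
  interpret loewner_radial_limits \<xi> g \<tau> \<beta>
    using assms by unfold_locales auto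
  show ?thesis
    using inverse_extends_continuously domain_is_unbounded_component by blast
qed

end
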